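(* Assume that there exists $\Phi=\{\Phi_k,k\in\mathbb{T}\}\in l^2(\mathbb{T};\mathbb{R}^m)$ such that the following two systems of difference equations are solvable (i.e. the quantities generated by the backward recursions satisfy the constraints $\mathcal{O}_k\mathcal{O}_k^\dagger\mathcal{L}_k=\mathcal{L}_k$ and $\mathcal{O}_k\mathcal{O}_k^\dagger\theta_k=\theta_k$ for all $k\in\mathbb{T}$): $$\left\{\begin{array}{l} T_k=S_{k+1}\Big[\big(s_k+(\mathbb{E}O_k)^T\Phi_k\big)(\mathbb{E}O_k)^T+\Phi_k^T\mathrm{Cov}(O_k)\Big]\big(-\mathcal{O}_k^\dagger\mathcal{L}_k-\Phi_k\big)\\ \qquad+T_{k+1}\Big[\big(s_k+(\mathbb{E}O_k)^T\Phi_k\big)\big(s_k-(\mathbb{E}O_k)^T\mathcal{O}_k^\dagger\mathcal{L}_k\big)-\Phi_k^T\mathrm{Cov}(O_k)\mathcal{O}_k^\dagger\mathcal{L}_k\Big],\\ \mathcal{T}_k=\Big[\mathcal{S}_{k+1}\big(s_k+(\mathbb{E}O_k)^T\Phi_k\big)(\mathbb{E}O_k)^T+S_{k+1}\Phi_k^T\mathrm{Cov}(O_k)\Big]\big(-\mathcal{O}_k^\dagger\mathcal{L}_k-\Phi_k\big)\\ \qquad+\Big[\mathcal{T}_{k+1}\big(s_k+(\mathbb{E}O_k)^T\Phi_k\big)\big(s_k-(\mathbb{E}O_k)^T\mathcal{O}_k^\dagger\mathcal{L}_k\big)-T_{k+1}\Phi_k^T\mathrm{Cov}(O_k)\mathcal{O}_k^\dagger\mathcal{L}_k\Big],\\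 T_N=0,\quad\mathcal{T}_N=0,\\ \mathcal{O}_k\mathcal{O}_k^\dagger\mathcal{L}_k=\mathcal{L}_k,\quad k\in\mathbb{T}, \end{array}\right.$$ and $$\left\{\begin{array}{l} \pi_k=-\beta_k\mathcal{O}_k^\dagger\theta_k+\big(s_k+(\mathbb{E}O_k)^T\Phi_k\big)\pi_{k+1},\\ \pi_N=-\frac{\mu_2}{2},\\ \mathcal{O}_k\mathcal{O}_k^\dagger\theta_k=\theta_k,\quad k\in\mathbb{T}, \end{array}\right.$$ where, for $k\in\mathbb{T}$, $$\mathcal{O}_k=\big(\mathcal{S}_{k+1}+\mathcal{T}_{k+1}\big)\mathbb{E}O_k(\mathbb{E}O_k)^T+\big(S_{k+1}+T_{k+1}\big)\mathrm{Cov}(O_k),$$ $$\mathcal{L}_k=s_k\big(\mathcal{S}_{k+1}+\mathcal{T}_{k+1}\big)\mathbb{E}O_k+U_{k+1}\mathbb{E}O_k,\qquad\theta_k=\pi_{k+1}\mathbb{E}O_k,$$ $$U_k=\big(s_k+(\mathbb{E}O_k)^T\Phi_k\big)U_{k+1},\qquad U_N=-\tfrac{\mu_1}{2},$$ $$\beta_k=\big(\mathcal{S}_{k+1}+\mathcal{T}_{k+1}\big)\big(s_k+\Phi_k^T\mathbb{E}O_k\big)(\mathbb{E}O_k)^T+\big(S_{k+1}+T_{k+1}\big)\Phi_k^T\mathrm{Cov}(O_k),$$ $$S_k=S_{k+1}\Big[\big(s_k+(\mathbb{E}O_k)^T\Phi_k\big)^2+\Phi_k^T\mathrm{Cov}(O_k)\Phi_k\Big],\qquad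 S_N=1,$$ $$\mathcal{S}_k=\mathcal{S}_{k+1}\big(s_k+(\mathbb{E}O_k)^T\Phi_k\big)^2+S_{k+1}\Phi_k^T\mathrm{Cov}(O_k)\Phi_k,\qquad\mathcal{S}_N=0.$$ For any $t\in\mathbb{T}$ and $x\in l^2_{\mathcal{F}}(t;\mathbb{R})$, let $$v^{t,x}_k=-\big(\mathcal{O}_k^\dagger\mathcal{L}_k+\Phi_k\big)X^{t,x,*}_k-\mathcal{O}_k^\dagger\theta_k,\qquad k\in\mathbb{T}_t,$$ where $$X^{t,x,*}_{k+1}=\big(s_k-O_k^T\mathcal{O}_k^\dagger\mathcal{L}_k\big)X^{t,x,*}_k-O_k^T\mathcal{O}_k^\dagger\theta_k,\quad k\in\mathbb{T}_t,\qquad X^{t,x,*}_t=x.$$ Then $(\Phi|_{\mathbb{T}_t},v^{t,x})$ is a mixed equilibrium solution of Problem (MV)$_{tx}$.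
   Context: Model. $N\ge 1$ and $m\ge 1$ are integers, $\mathbb{T}=\{0,\dots,N-1\}$, $\mathbb{T}_t=\{t,\dots,N-1\}$. For $k\in\mathbb{T}$, $s_k>1$ is a given deterministic number (return of the riskless asset) and $e_k=(e_k^1,\dots,e_k^m)^T$ is an $\mathbb{R}^m$-valued random vector with finite second moments (returns of $m$ risky assets); $e_0,\dots,e_{N-1}$ are independent. $O_k=(e_k^1-s_k,\dots,e_k^m-s_k)^T$ is the excess return vector, and $\mathrm{Cov}(O_k)=\mathrm{Cov}(e_k)=\mathbb{E}[(e_k-\mathbb{E}e_k)(e_k-\mathbb{E}e_k)^T]\succeq0$ (not assumed nonsingular). $\mathcal{F}_k=\sigma(e_\ell,\ \ell=0,\dots,k-1)$ ($\mathcal{F}_0$ trivial) and $\mathbb{E}_t=\mathbb{E}[\,\cdot\,|\mathcal{F}_t]$. $l^2_{\mathcal{F}}(k;\mathbb{R}^d)$ is the set of $\mathcal{F}_k$-measurable square-integrable $\mathbb{R}^d$-valued random variables; $l^2_{\mathcal{F}}(\mathbb{T}_t;\mathbb{R}^m)$ is the set of processes $\{\nu_k,k\in\mathbb{T}_t\}$ with $\nu_k\in l^2_{\mathcal{F}}(k;\mathbb{R}^m)$ for each $k\in\mathbb{T}_t$; $l^2(\mathbb{T}_t;\mathbb{R}^m)$ is the set of deterministic sequences $\{\nu_k\in\mathbb{R}^m,k\in\mathbb{T}_t\}$ (and $l^2(\mathbb{T};\mathbb{R}^m)$ likewise). Problem (MV)$_{tx}$ (multi-period mean-variance problem for the initial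 pair $(t,x)$, $t\in\mathbb{T}$, $x\in l^2_{\mathcal{F}}(t;\mathbb{R})$): with controls $u\in l^2_{\mathcal{F}}(\mathbb{T}_t;\mathbb{R}^m)$ (short-selling allowed), wealth dynamics $X_{k+1}=s_kX_k+O_k^Tu_k$, $k\in\mathbb{T}_t$, $X_t=x$, and cost $$J(t,x;u)=\mathbb{E}_t(X_N-\mathbb{E}_tX_N)^2-(\mu_1x+\mu_2)\mathbb{E}_tX_N,$$ where $\mu_1,\mu_2>0$ are constants. Mixed equilibrium solution. A pair $(\Phi,v^{t,x})\in l^2(\mathbb{T}_t;\mathbb{R}^m)\times l^2_{\mathcal{F}}(\mathbb{T}_t;\mathbb{R}^m)$ is a mixed equilibrium solution of Problem (MV)$_{tx}$ if (a) $\Phi$ does not depend on $x$, while $v^{t,x}$ may depend on $x$; (b) for every $k\in\mathbb{T}_t$ and every $u_k\in l^2_{\mathcal{F}}(k;\mathbb{R}^m)$, $$J\big(k,X_k^{t,x,*};(\Phi_kX_k^{k,\Phi}+v^{t,x}_k,\dots,\Phi_{N-1}X_{N-1}^{k,\Phi}+v^{t,x}_{N-1})\big)\le J\big(k,X_k^{t,x,*};(u_k,\Phi_{k+1}X_{k+1}^{k,u_k,\Phi}+v^{t,x}_{k+1},\dots,\Phi_{N-1}X_{N-1}^{k,u_k,\Phi}+v^{t,x}_{N-1})\big)\quad\text{a.s.},$$ where $X^{t,x,*}_{\ell+1}=(s_\ell+O_\ell^T\Phi_\ell)X^{t,x,*}_\ell+O_\ell^Tv^{t,x}_\ell$ for $\ell\in\mathbb{T}_t$,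 $X^{t,x,*}_t=x$; $X^{k,\Phi}_{\ell+1}=(s_\ell+O_\ell^T\Phi_\ell)X^{k,\Phi}_\ell+O_\ell^Tv^{t,x}_\ell$ for $\ell\in\mathbb{T}_k$, $X^{k,\Phi}_k=X^{t,x,*}_k$; and $X^{k,u_k,\Phi}_{\ell+1}=(s_\ell+O_\ell^T\Phi_\ell)X^{k,u_k,\Phi}_\ell+O_\ell^Tv^{t,x}_\ell$ for $\ell\in\mathbb{T}_{k+1}=\{k+1,\dots,N-1\}$, $X^{k,u_k,\Phi}_{k+1}=s_kX^{k,u_k,\Phi}_k+O_k^Tu_k$, $X^{k,u_k,\Phi}_k=X^{t,x,*}_k$. The same process $v^{t,x}$ is used on both sides of the inequality. Notation: $A^\dagger$ is the Moore–Penrose inverse; $\Phi|_{\mathbb{T}_t}$ is the restriction of $\Phi$ to $\mathbb{T}_t$. $S_k,\mathcal{S}_k,T_k,\mathcal{T}_k,U_k,\pi_k$ are scalars, $\mathcal{O}_k\in\mathbb{R}^{m\times m}$, $\mathcal{L}_k,\theta_k,\Phi_k\in\mathbb{R}^m$ are column vectors, $\beta_k$ is a row vector. *)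

theory Defs
  imports "HOL-Probability.Probability"
begin

definition is_moore_penrose :: "real^'n^'m \<Rightarrow> real^'m^'n \<Rightarrow> bool" where
  "is_moore_penrose A B \<longleftrightarrow>
     A ** B ** A = A \<and> B ** A ** B = B \<and>
     transpose (A ** B) = A ** B \<and> transpose (B ** A) = B ** A"

text \<open>The four Penrose conditions determine a unique matrix.\<close>
definition moore_penrose :: "real^'n^'m \<Rightarrow> real^'m^'n" where
  "moore_penrose A = (THE B. is_moore_penrose A B)"

definition outer :: "real^'m \<Rightarrow> real^'n \<Rightarrow> real^'n^'m" where
  "outer a b = (\<chi> i j. a $ i * b $ j)"

definition covariance_matrix :: "'a measure \<Rightarrow> ('a \<Rightarrow> real^'m) \<Rightarrow> real^'m^'m" where
  "covariance_matrix M Z =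
     (\<chi> i j. \<integral>\<omega>. outer (Z \<omega> - (\<integral>\<omega>'. Z \<omega>' \<partial>M)) (Z \<omega> - (\<integral>\<omega>'. Z \<omega>' \<partial>M)) $ i $ j \<partial>M)"

definition excess :: "(nat \<Rightarrow> real) \<Rightarrow> (nat \<Rightarrow> 'a \<Rightarrow> real^'m) \<Rightarrow> nat \<Rightarrow> 'a \<Rightarrow> real^'m" where
  "excess s e k \<omega> = (\<chi> i. e k \<omega> $ i - s k)"

definition info :: "'a measure \<Rightarrow> (nat \<Rightarrow> 'a \<Rightarrow> real^'m) \<Rightarrow> nat \<Rightarrow> 'a measure" where
  "info M e k = sigma (space M) {e l -` A \<inter> space M | l A. l < k \<and> A \<in> sets borel}"

definition L2_adapted ::
  "'a measure \<Rightarrow> (nat \<Rightarrow> 'a \<Rightarrow> real^'m) \<Rightarrow> nat \<Rightarrow> ('a \<Rightarrow> 'b::euclidean_space) set" where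
  "L2_adapted M e k =
     {\<xi>. \<xi> \<in> borel_measurable (info M e k) \<and> integrable M (\<lambda>\<omega>. (norm (\<xi> \<omega>))\<^sup>2)}"

text \<open>Trajectories started at time \<open>t\<close> are total in the time argument; their values before
  \<open>t\<close> are set to the initial state and never used.\<close>
primrec wealth ::
  "(nat \<Rightarrow> real) \<Rightarrow> (nat \<Rightarrow> 'a \<Rightarrow> real^'m) \<Rightarrow> nat \<Rightarrow> ('a \<Rightarrow> real) \<Rightarrow> (nat \<Rightarrow> 'a \<Rightarrow> real^'m)
     \<Rightarrow> nat \<Rightarrow> 'a \<Rightarrow> real" where
  "wealth s e t x u 0 = x"
| "wealth s e t x u (Suc l) =
     (if Suc l \<le> t then x
      else (\<lambda>\<omega>. s l * wealth s e t x u l \<omega> + excess s e l \<omega> \<bullet> u l \<omega>))"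

definition mv_cost ::
  "'a measure \<Rightarrow> nat \<Rightarrow> (nat \<Rightarrow> real) \<Rightarrow> (nat \<Rightarrow> 'a \<Rightarrow> real^'m) \<Rightarrow> real \<Rightarrow> real
     \<Rightarrow> nat \<Rightarrow> ('a \<Rightarrow> real) \<Rightarrow> (nat \<Rightarrow> 'a \<Rightarrow> real^'m) \<Rightarrow> 'a \<Rightarrow> real" where
  "mv_cost M N s e \<mu>1 \<mu>2 t x u =
     (let E = real_cond_exp M (info M e t); X = wealth s e t x u N
      in (\<lambda>\<omega>. E (\<lambda>\<omega>'. (X \<omega>' - E X \<omega>')\<^sup>2) \<omega> - (\<mu>1 * x \<omega> + \<mu>2) * E X \<omega>))"

primrec feedback_wealth ::
  "(nat \<Rightarrow> real) \<Rightarrow> (nat \<Rightarrow> 'a \<Rightarrow> real^'m) \<Rightarrow> (nat \<Rightarrow> real^'m) \<Rightarrow> (nat \<Rightarrow> 'a \<Rightarrow> real^'m)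
     \<Rightarrow> nat \<Rightarrow> ('a \<Rightarrow> real) \<Rightarrow> nat \<Rightarrow> 'a \<Rightarrow> real" where
  "feedback_wealth s e \<Phi> v t x 0 = x"
| "feedback_wealth s e \<Phi> v t x (Suc l) =
     (if Suc l \<le> t then x
      else (\<lambda>\<omega>. (s l + excess s e l \<omega> \<bullet> \<Phi> l) * feedback_wealth s e \<Phi> v t x l \<omega>
                 + excess s e l \<omega> \<bullet> v l \<omega>))"

definition deviation_wealth ::
  "(nat \<Rightarrow> real) \<Rightarrow> (nat \<Rightarrow> 'a \<Rightarrow> real^'m) \<Rightarrow> (nat \<Rightarrow> real^'m) \<Rightarrow> (nat \<Rightarrow> 'a \<Rightarrow> real^'m)
     \<Rightarrow> nat \<Rightarrow> ('a \<Rightarrow> real) \<Rightarrow> ('a \<Rightarrow> real^'m) \<Rightarrow> nat \<Rightarrow> 'a \<Rightarrow> real" where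
  "deviation_wealth s e \<Phi> v k y w l =
     (if l \<le> k then y
      else feedback_wealth s e \<Phi> v (Suc k) (\<lambda>\<omega>. s k * y \<omega> + excess s e k \<omega> \<bullet> w \<omega>) l)"

text \<open>The pure-feedback part \<open>\<Phi>\<close> is deterministic and, being quantified before the initial
  state \<open>x\<close> wherever this predicate is used, does not depend on \<open>x\<close>. The open-loop part \<open>v\<close>
  may depend on \<open>x\<close> and is kept unchanged in the deviating control. Only the values of
  \<open>\<Phi>\<close> and \<open>v\<close> on \<open>{t..<N}\<close> matter.\<close>
definition mixed_equilibrium ::
  "'a measure \<Rightarrow> nat \<Rightarrow> (nat \<Rightarrow> real) \<Rightarrow> (nat \<Rightarrow> 'a \<Rightarrow> real^'m) \<Rightarrow> real \<Rightarrow> real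
     \<Rightarrow> nat \<Rightarrow> ('a \<Rightarrow> real) \<Rightarrow> (nat \<Rightarrow> real^'m) \<Rightarrow> (nat \<Rightarrow> 'a \<Rightarrow> real^'m) \<Rightarrow> bool" where
  "mixed_equilibrium M N s e \<mu>1 \<mu>2 t x \<Phi> v \<longleftrightarrow>
     (\<forall>k\<in>{t..<N}. v k \<in> L2_adapted M e k) \<and>
     (\<forall>k\<in>{t..<N}. \<forall>w\<in>L2_adapted M e k.
        let y = feedback_wealth s e \<Phi> v t x k;
            X = feedback_wealth s e \<Phi> v k y;
            X' = deviation_wealth s e \<Phi> v k y w
        in AE \<omega> in M.
             mv_cost M N s e \<mu>1 \<mu>2 k y (\<lambda>l \<omega>. X l \<omega> *\<^sub>R \<Phi> l + v l \<omega>) \<omega>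
             \<le> mv_cost M N s e \<mu>1 \<mu>2 k y
                  (\<lambda>l. if l = k then w else (\<lambda>\<omega>. X' l \<omega> *\<^sub>R \<Phi> l + v l \<omega>)) \<omega>)"

end

theory Submission
  imports Defs
begin

text \<open>
  Put \<open>a = moore_penrose \<O> \<L>\<close> and \<open>b = moore_penrose \<O> \<theta>\<close>; only the solvability relations
  \<open>\<O> a = \<L>\<close> and \<open>\<O> b = \<theta>\<close> matter. Changing the control at time \<open>k\<close> by \<open>h\<close>, with the
  open-loop part \<open>v\<close> frozen, adds to the wealth a process \<open>D\<close> with
  \<open>D (k+1) = O k \<bullet> h\<close> and \<open>D (l+1) = (s l + O l \<bullet> \<Phi> l) D l\<close>. The cost then grows by
  the conditional variance of \<open>D N\<close> plus a term linear in \<open>D N\<close>, which has to vanish. Writing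
  \<open>E\<close> for the conditional expectation at time \<open>k\<close>, the backward recursions say that
  \<open>(S + T) (E (X D) - E X E D) + (\<S> + \<T>) E X E D + (\<pi> + U X k) E D\<close>
  does not depend on \<open>l > k\<close>. At \<open>l = k + 1\<close> it is zero by the two solvability relations, and
  at \<open>l = N\<close> it is half of the linear term.
\<close>

section \<open>Square-integrable functions measurable for a given sigma-algebra\<close>

text \<open>One class serves three sigma-algebras: the information at a time, the noise of a single
  period, and \<open>M\<close> itself.\<close>

definition L2 :: "'a measure \<Rightarrow> 'a measure \<Rightarrow> ('a \<Rightarrow> 'b::euclidean_space) set" where
  "L2 M F = {f. f \<in> borel_measurable F \<and> integrable M (\<lambda>\<omega>. (norm (f \<omega>))\<^sup>2)}"

lemma L2_adapted_eq_L2: "L2_adapted M e k = L2 M (info M e k)"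
  by (simp add: L2_adapted_def L2_def)

lemma L2_subalgebra_mono:
  assumes "subalgebra G F" "f \<in> L2 M F" shows "f \<in> L2 M G"
  using assms measurable_from_subalg unfolding L2_def by blast

text \<open>Reduces closure properties of \<open>L2\<close> to measurability plus an elementary norm
  inequality.\<close>

lemma L2_dominated:
  assumes sub: "subalgebra M F" and f: "f \<in> borel_measurable F"
    and g: "integrable M g" and bound: "\<And>\<omega>. (norm (f \<omega>))\<^sup>2 \<le> g \<omega>"
  shows "f \<in> L2 M F"
proof -
  have [measurable]: "f \<in> borel_measurable M"
    using measurable_from_subalg[OF sub f] .
  have "integrable M (\<lambda>\<omega>. (norm (f \<omega>))\<^sup>2)"
  proof (rule Bochner_Integration.integrable_bound[OF g])
    show "AE \<omega> in M. norm ((norm (f \<omega>))\<^sup>2) \<le> norm (g \<omega>)"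
      using bound by (auto intro: order_trans[OF _ abs_ge_self])
  qed measurable
  then show ?thesis using f by (simp add: L2_def)
qed

lemma L2_add:
  assumes sub: "subalgebra M F" and f: "f \<in> L2 M F" and g: "g \<in> L2 M F"
  shows "(\<lambda>\<omega>. f \<omega> + g \<omega>) \<in> L2 M F"
proof (rule L2_dominated[OF sub])
  show "integrable M (\<lambda>\<omega>. 2 * (norm (f \<omega>))\<^sup>2 + 2 * (norm (g \<omega>))\<^sup>2)"
    using f g by (simp add: L2_def)
  show "(\<lambda>\<omega>. f \<omega> + g \<omega>) \<in> borel_measurable F"
    using f g by (auto simp: L2_def intro: borel_measurable_add)
  fix \<omega>
  have "(norm (f \<omega> + g \<omega>))\<^sup>2 \<le> (norm (f \<omega>) + norm (g \<omega>))\<^sup>2"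
    by (intro power_mono norm_triangle_ineq) simp
  also have "\<dots> \<le> 2 * (norm (f \<omega>))\<^sup>2 + 2 * (norm (g \<omega>))\<^sup>2"
    using sum_squares_bound[of "norm (f \<omega>)" "norm (g \<omega>)"] by (simp add: power2_sum)
  finally show "(norm (f \<omega> + g \<omega>))\<^sup>2 \<le> 2 * (norm (f \<omega>))\<^sup>2 + 2 * (norm (g \<omega>))\<^sup>2" .
qed

text \<open>Covers negation, coordinates, inner products with a fixed vector and multiples of a
  fixed vector at once.\<close>

lemma L2_linear:
  assumes sub: "subalgebra M F" and f: "f \<in> L2 M F" and T: "bounded_linear T"
  shows "(\<lambda>\<omega>. T (f \<omega>)) \<in> L2 M F"
proof -
  obtain K where K: "\<And>x. norm (T x) \<le> norm x * K"
    using bounded_linear.bounded[OF T] by blast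
  show ?thesis
  proof (rule L2_dominated[OF sub])
    show "integrable M (\<lambda>\<omega>. K\<^sup>2 * (norm (f \<omega>))\<^sup>2)"
      using f by (simp add: L2_def)
    have "T \<in> borel_measurable borel"
      using T by (intro borel_measurable_continuous_onI linear_continuous_on)
    then show "(\<lambda>\<omega>. T (f \<omega>)) \<in> borel_measurable F"
      using f measurable_compose[of f F borel T] by (simp add: L2_def)
    show "(norm (T (f \<omega>)))\<^sup>2 \<le> K\<^sup>2 * (norm (f \<omega>))\<^sup>2" for \<omega>
      using power_mono[OF K norm_ge_zero, of "f \<omega>" 2] by (simp add: power_mult_distrib mult.commute)
  qed
qed

lemma L2_diff:
  assumes sub: "subalgebra M F" and f: "f \<in> L2 M F" and g: "g \<in> L2 M F"
  shows "(\<lambda>\<omega>. f \<omega> - g \<omega>) \<in> L2 M F"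
  using L2_add[OF sub f L2_linear[OF sub g, of uminus]]
  by (simp add: bounded_linear_minus)

lemma (in finite_measure) L2_const: "(\<lambda>_. c) \<in> L2 M F"
  by (simp add: L2_def)

lemma L2_inner_integrable:
  assumes sub: "subalgebra M F" and f: "f \<in> L2 M F" and g: "g \<in> L2 M F"
  shows "integrable M (\<lambda>\<omega>. f \<omega> \<bullet> g \<omega>)"
proof (rule Bochner_Integration.integrable_bound)
  show "integrable M (\<lambda>\<omega>. (norm (f \<omega>))\<^sup>2 + (norm (g \<omega>))\<^sup>2)"
    using f g by (simp add: L2_def)
  have [measurable]: "f \<in> borel_measurable M" "g \<in> borel_measurable M"
    using f g measurable_from_subalg[OF sub] by (auto simp: L2_def)
  show "(\<lambda>\<omega>. f \<omega> \<bullet> g \<omega>) \<in> borel_measurable M" by measurable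
  show "AE \<omega> in M. norm (f \<omega> \<bullet> g \<omega>) \<le> norm ((norm (f \<omega>))\<^sup>2 + (norm (g \<omega>))\<^sup>2)"
  proof (rule AE_I2)
    fix \<omega>
    have "norm (f \<omega> \<bullet> g \<omega>) \<le> norm (f \<omega>) * norm (g \<omega>)"
      using Cauchy_Schwarz_ineq2 by simp
    also have "\<dots> \<le> (norm (f \<omega>))\<^sup>2 + (norm (g \<omega>))\<^sup>2"
      using sum_squares_bound[of "norm (f \<omega>)" "norm (g \<omega>)"]
        mult_nonneg_nonneg[OF norm_ge_zero norm_ge_zero, of "f \<omega>" "g \<omega>"] by linarith
    finally show "norm (f \<omega> \<bullet> g \<omega>) \<le> norm ((norm (f \<omega>))\<^sup>2 + (norm (g \<omega>))\<^sup>2)" by simp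
  qed
qed

lemma L2_mult_integrable:
  fixes f g :: "'a \<Rightarrow> real"
  assumes "subalgebra M F" "f \<in> L2 M F" "g \<in> L2 M F"
  shows "integrable M (\<lambda>\<omega>. f \<omega> * g \<omega>)"
  using L2_inner_integrable[OF assms] by simp

lemma L2_scaleR_integrable:
  fixes f :: "'a \<Rightarrow> real" and g :: "'a \<Rightarrow> 'b::euclidean_space"
  assumes sub: "subalgebra M F" and f: "f \<in> L2 M F" and g: "g \<in> L2 M F"
  shows "integrable M (\<lambda>\<omega>. f \<omega> *\<^sub>R g \<omega>)"
proof -
  have "integrable M (\<lambda>\<omega>. \<Sum>i\<in>Basis. (f \<omega> * (g \<omega> \<bullet> i)) *\<^sub>R i)"
    using L2_mult_integrable[OF sub f L2_linear[OF sub g bounded_linear_inner_left]]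
    by (intro Bochner_Integration.integrable_sum integrable_scaleR_left) auto
  moreover have "f \<omega> *\<^sub>R g \<omega> = (\<Sum>i\<in>Basis. (f \<omega> * (g \<omega> \<bullet> i)) *\<^sub>R i)" for \<omega>
    using euclidean_representation[of "f \<omega> *\<^sub>R g \<omega>"] by simp
  ultimately show ?thesis by simp
qed

lemma (in finite_measure) L2_integrable:
  assumes sub: "subalgebra M F" and f: "f \<in> L2 M F"
  shows "integrable M f"
  using L2_scaleR_integrable[OF sub L2_const[of 1] f] by simp

section \<open>Conditional expectation and conditional variance\<close>

text \<open>Jensen's inequality for the convex square function.\<close>

lemma (in finite_measure) L2_cond_exp:
  fixes f :: "'a \<Rightarrow> real"
  assumes sub: "subalgebra M F" and f: "f \<in> L2 M G" and G: "subalgebra M G"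
  shows "real_cond_exp M F f \<in> L2 M F"
proof -
  interpret finite_measure_subalgebra M F
    by (unfold_locales) (rule sub)
  have "integrable M (\<lambda>\<omega>. (real_cond_exp M F f \<omega>)\<^sup>2)"
    by (rule integrable_convex_cond_exp[where I = UNIV])
      (use f L2_integrable[OF G f] in \<open>auto simp: L2_def convex_power2\<close>)
  then show ?thesis by (simp add: L2_def)
qed

text \<open>The first-order condition makes the cost of the perturbed terminal wealth exceed the
  original one by exactly the conditional variance of the perturbation.\<close>
lemma (in finite_measure) cond_mean_variance_le:
  fixes X D \<kappa> :: "'a \<Rightarrow> real"
  assumes sub: "subalgebra M F" and G: "subalgebra M G"
    and X: "X \<in> L2 M G" and D: "D \<in> L2 M G"
  defines "E \<equiv> real_cond_exp M F"
  assumes first_order: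
    "AE \<omega> in M. 2 * (E (\<lambda>\<omega>. X \<omega> * D \<omega>) \<omega> - E X \<omega> * E D \<omega>) = \<kappa> \<omega> * E D \<omega>"
  shows "AE \<omega> in M. E (\<lambda>\<omega>'. (X \<omega>' - E X \<omega>')\<^sup>2) \<omega> - \<kappa> \<omega> * E X \<omega>
    \<le> E (\<lambda>\<omega>'. (X \<omega>' + D \<omega>' - E (\<lambda>\<omega>. X \<omega> + D \<omega>) \<omega>')\<^sup>2) \<omega>
       - \<kappa> \<omega> * E (\<lambda>\<omega>. X \<omega> + D \<omega>) \<omega>"
proof -
  interpret finite_measure_subalgebra M F
    by (unfold_locales) (rule sub)
  have MM: "subalgebra M M" by (simp add: subalgebra_def)
  have XM: "X \<in> L2 M M" and DM: "D \<in> L2 M M"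
    using X D L2_subalgebra_mono[OF G] by blast+
  have EX: "E X \<in> L2 M M" and ED: "E D \<in> L2 M M"
    unfolding E_def using L2_subalgebra_mono[OF sub] L2_cond_exp[OF sub _ MM] XM DM by blast+
  have [measurable]: "E f \<in> borel_measurable F" "E f \<in> borel_measurable M" for f
    unfolding E_def by auto
  have [measurable]: "X \<in> borel_measurable M" "D \<in> borel_measurable M"
    using XM DM by (auto simp: L2_def)
  note int = L2_integrable[OF MM]
  note mul = L2_mult_integrable[OF MM]
  \<comment> \<open>\<open>A\<close> and \<open>B\<close> are the conditionally centred parts of
    \<open>X\<close> and \<open>D\<close>; the perturbed terminal wealth has centred part
    \<open>A + B\<close>.\<close>
  define A where "A \<omega> = X \<omega> - E X \<omega>" for \<omega>
  define B where "B \<omega> = D \<omega> - E D \<omega>" for \<omega>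
  have A: "A \<in> L2 M M" and B: "B \<in> L2 M M"
    unfolding A_def[abs_def] B_def[abs_def] using L2_diff[OF MM] XM EX DM ED by blast+
  have [measurable]: "A \<in> borel_measurable M" "B \<in> borel_measurable M"
    using A B by (auto simp: L2_def)
  have sum: "AE \<omega> in M. E (\<lambda>\<omega>. X \<omega> + D \<omega>) \<omega> = E X \<omega> + E D \<omega>"
    unfolding E_def by (rule real_cond_exp_add) (auto intro: int XM DM)
  \<comment> \<open>The splitting of \<open>E (X + D)\<close> holds only almost everywhere, so the
    expanded square is carried under \<open>E\<close> by a congruence that tolerates null
    sets.\<close>
  have "AE \<omega> in M. E (\<lambda>\<omega>'. (X \<omega>' + D \<omega>' - E (\<lambda>\<omega>. X \<omega> + D \<omega>) \<omega>')\<^sup>2) \<omega>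
      = E (\<lambda>\<omega>'. A \<omega>' * A \<omega>' + (2 * (A \<omega>' * B \<omega>') + B \<omega>' * B \<omega>')) \<omega>"
    unfolding E_def
  proof (rule real_cond_exp_cong)
    show "AE \<omega> in M. (X \<omega> + D \<omega> - real_cond_exp M F (\<lambda>\<omega>. X \<omega> + D \<omega>) \<omega>)\<^sup>2 =
        A \<omega> * A \<omega> + (2 * (A \<omega> * B \<omega>) + B \<omega> * B \<omega>)"
      using sum by eventually_elim
        (simp add: E_def A_def B_def power2_eq_square algebra_simps)
  qed measurable
  moreover have "AE \<omega> in M. E (\<lambda>\<omega>'. A \<omega>' * A \<omega>' + (2 * (A \<omega>' * B \<omega>') + B \<omega>' * B \<omega>')) \<omega>
      = E (\<lambda>\<omega>'. A \<omega>' * A \<omega>') \<omega> + E (\<lambda>\<omega>'. 2 * (A \<omega>' * B \<omega>') + B \<omega>' * B \<omega>') \<omega>"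
    unfolding E_def by (rule real_cond_exp_add)
      (auto intro!: mul A B Bochner_Integration.integrable_add integrable_mult_right)
  moreover have "AE \<omega> in M. E (\<lambda>\<omega>'. 2 * (A \<omega>' * B \<omega>') + B \<omega>' * B \<omega>') \<omega>
      = E (\<lambda>\<omega>'. 2 * (A \<omega>' * B \<omega>')) \<omega> + E (\<lambda>\<omega>'. B \<omega>' * B \<omega>') \<omega>"
    unfolding E_def by (rule real_cond_exp_add) (auto intro!: mul A B integrable_mult_right)
  moreover have "AE \<omega> in M. E (\<lambda>\<omega>'. 2 * (A \<omega>' * B \<omega>')) \<omega> = 2 * E (\<lambda>\<omega>'. A \<omega>' * B \<omega>') \<omega>"
    unfolding E_def by (rule real_cond_exp_cmult) (auto intro!: mul A B)
  moreover have "AE \<omega> in M. 0 \<le> E (\<lambda>\<omega>'. B \<omega>' * B \<omega>') \<omega>"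
    unfolding E_def by (rule real_cond_exp_pos) auto
  \<comment> \<open>The cross term is the conditional covariance of \<open>X\<close> and
    \<open>D\<close>: \<open>E A\<close> vanishes, so centring \<open>D\<close> changes nothing, and
    centring \<open>X\<close> subtracts \<open>E X * E D\<close>. By \<open>first_order\<close>,
    twice this covariance cancels the change of the linear cost, and only \<open>E (B * B)\<close>
    remains.\<close>
  moreover have "AE \<omega> in M. E (\<lambda>\<omega>'. A \<omega>' * B \<omega>') \<omega>
      = E (\<lambda>\<omega>'. A \<omega>' * D \<omega>') \<omega> - E (\<lambda>\<omega>'. E D \<omega>' * A \<omega>') \<omega>"
  proof -
    have eq: "(\<lambda>\<omega>'. A \<omega>' * B \<omega>') = (\<lambda>\<omega>'. A \<omega>' * D \<omega>' - E D \<omega>' * A \<omega>')"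
      by (simp add: B_def algebra_simps)
    show ?thesis
      unfolding eq unfolding E_def
      by (rule real_cond_exp_diff) (auto intro!: mul A DM ED[unfolded E_def])
  qed
  moreover have "AE \<omega> in M. E (\<lambda>\<omega>'. A \<omega>' * D \<omega>') \<omega>
      = E (\<lambda>\<omega>'. X \<omega>' * D \<omega>') \<omega> - E (\<lambda>\<omega>'. E X \<omega>' * D \<omega>') \<omega>"
  proof -
    have eq: "(\<lambda>\<omega>'. A \<omega>' * D \<omega>') = (\<lambda>\<omega>'. X \<omega>' * D \<omega>' - E X \<omega>' * D \<omega>')"
      by (simp add: A_def algebra_simps)
    show ?thesis
      unfolding eq unfolding E_def
      by (rule real_cond_exp_diff) (auto intro!: mul XM DM EX[unfolded E_def])
  qed
  moreover have "AE \<omega> in M. E (\<lambda>\<omega>'. E X \<omega>' * D \<omega>') \<omega> = E X \<omega> * E D \<omega>"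
    unfolding E_def by (rule real_cond_exp_mult) (auto intro!: mul DM EX[unfolded E_def])
  moreover have "AE \<omega> in M. E (\<lambda>\<omega>'. E D \<omega>' * A \<omega>') \<omega> = E D \<omega> * E A \<omega>"
    unfolding E_def by (rule real_cond_exp_mult) (auto intro!: mul A ED[unfolded E_def])
  moreover have "AE \<omega> in M. E A \<omega> = E X \<omega> - E (E X) \<omega>"
    unfolding A_def[abs_def] E_def
    by (rule real_cond_exp_diff) (auto intro!: int XM EX[unfolded E_def])
  moreover have "AE \<omega> in M. E (E X) \<omega> = E X \<omega>"
    unfolding E_def by (rule real_cond_exp_F_meas) (auto intro!: int EX[unfolded E_def])
  moreover note sum first_order
  ultimately have "AE \<omega> in M. E (\<lambda>\<omega>'. A \<omega>' * A \<omega>') \<omega> - \<kappa> \<omega> * E X \<omega>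
    \<le> E (\<lambda>\<omega>'. (X \<omega>' + D \<omega>' - E (\<lambda>\<omega>. X \<omega> + D \<omega>) \<omega>')\<^sup>2) \<omega>
       - \<kappa> \<omega> * E (\<lambda>\<omega>. X \<omega> + D \<omega>) \<omega>"
    by eventually_elim (simp add: algebra_simps)
  then show ?thesis by (simp add: A_def power2_eq_square)
qed

section \<open>Noise of one period and the covariance form\<close>

text \<open>The sigma-algebra generated by the single return \<open>e k\<close>. For
  \<open>k < N\<close> it is independent of the information at time \<open>k\<close>, which is how
  independence of the returns enters every moment computation.\<close>

definition noise :: "'a measure \<Rightarrow> (nat \<Rightarrow> 'a \<Rightarrow> real^'m) \<Rightarrow> nat \<Rightarrow> 'a measure" where
  "noise M e k = vimage_algebra (space M) (e k) borel"

text \<open>Replaces the entrywise covariance matrix by a bilinear form in scalar projections, the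
  only form in which it occurs in the later computations.\<close>

lemma covariance_bilinear:
  fixes Z :: "'a \<Rightarrow> real^'m"
  assumes fin: "finite_measure M" and Z: "Z \<in> L2 M M"
  shows "(a v* covariance_matrix M Z) \<bullet> b
    = (\<integral>\<omega>. ((Z \<omega> - (\<integral>\<omega>. Z \<omega> \<partial>M)) \<bullet> a) * ((Z \<omega> - (\<integral>\<omega>. Z \<omega> \<partial>M)) \<bullet> b) \<partial>M)"
proof -
  interpret finite_measure M by (rule fin)
  have MM: "subalgebra M M" by (simp add: subalgebra_def)
  define V where "V \<omega> = Z \<omega> - (\<integral>\<omega>. Z \<omega> \<partial>M)" for \<omega>
  have V: "V \<in> L2 M M"
    unfolding V_def[abs_def] by (rule L2_diff[OF MM Z L2_const])
  have int: "integrable M (\<lambda>\<omega>. V \<omega> $ i * V \<omega> $ j)" for i j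
    using L2_mult_integrable[OF MM L2_linear[OF MM V bounded_linear_vec_nth]
        L2_linear[OF MM V bounded_linear_vec_nth]] .
  have "(\<integral>\<omega>. (V \<omega> \<bullet> a) * (V \<omega> \<bullet> b) \<partial>M)
      = (\<integral>\<omega>. (\<Sum>i\<in>UNIV. \<Sum>j\<in>UNIV. a $ i * b $ j * (V \<omega> $ i * V \<omega> $ j)) \<partial>M)"
    by (simp add: inner_vec_def sum_product mult_ac)
  also have "\<dots> = (\<Sum>i\<in>UNIV. \<Sum>j\<in>UNIV. a $ i * b $ j * (\<integral>\<omega>. V \<omega> $ i * V \<omega> $ j \<partial>M))"
    by (simp add: Bochner_Integration.integral_sum Bochner_Integration.integrable_sum
        integrable_mult_right int)
  also have "\<dots> = a \<bullet> (covariance_matrix M Z *v b)"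
    by (simp add: inner_vec_def matrix_vector_mult_def covariance_matrix_def outer_def
        V_def sum_distrib_left mult_ac)
  finally show ?thesis by (simp add: V_def dot_lmul_matrix)
qed

section \<open>The market, its filtration, and independence of the next return from the past\<close>

locale market = prob_space M for M :: "'a measure" +
  fixes N :: nat and s :: "nat \<Rightarrow> real" and e :: "nat \<Rightarrow> 'a \<Rightarrow> real^'m"
  assumes returns_indep: "indep_vars (\<lambda>_. borel) e {..<N}"
    and returns_measurable: "k < N \<Longrightarrow> e k \<in> borel_measurable M"
    and returns_square_integrable: "k < N \<Longrightarrow> integrable M (\<lambda>\<omega>. (norm (e k \<omega>))\<^sup>2)"
begin

lemma sets_info:
  "sets (info M e k)
    = sigma_sets (space M) {e l -` A \<inter> space M | l A. l < k \<and> A \<in> sets borel}"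
  unfolding info_def by (rule sets_measure_of) auto

lemma space_info: "space (info M e k) = space M"
  unfolding info_def by (rule space_measure_of) auto

lemma subalgebra_info_mono:
  assumes "j \<le> k"
  shows "subalgebra (info M e k) (info M e j)"
proof -
  have "{e l -` A \<inter> space M | l A. l < j \<and> A \<in> sets borel}
      \<subseteq> {e l -` A \<inter> space M | l A. l < k \<and> A \<in> sets borel}"
    using assms by (blast intro: less_le_trans)
  then show ?thesis
    unfolding subalgebra_def space_info sets_info by (simp add: sigma_sets_mono')
qed

lemma subalgebra_info:
  assumes "k \<le> N"
  shows "subalgebra M (info M e k)"
proof -
  have "{e l -` A \<inter> space M | l A. l < k \<and> A \<in> sets borel} \<subseteq> sets M"
    using assms measurable_sets[OF returns_measurable] by fastforce
  then show ?thesis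
    unfolding subalgebra_def space_info sets_info by (simp add: sets.sigma_sets_subset)
qed

lemma sets_noise: "sets (noise M e k) = {e k -` A \<inter> space M | A. A \<in> sets borel}"
  unfolding noise_def by (rule sets_vimage_algebra2) simp

lemma space_noise: "space (noise M e k) = space M"
  by (simp add: noise_def)

lemma subalgebra_noise: "k < N \<Longrightarrow> subalgebra M (noise M e k)"
  unfolding subalgebra_def space_noise sets_noise
  using measurable_sets[OF returns_measurable] by fastforce

lemma subalgebra_info_noise: "l < k \<Longrightarrow> subalgebra (info M e k) (noise M e l)"
  unfolding subalgebra_def space_noise space_info sets_noise sets_info
  by (intro conjI refl subsetI sigma_sets.Basic) blast

text \<open>Preimages of Borel sets under one return are closed under intersection, so independence
  of the periods passes to the sigma-algebras generated by disjoint blocks of periods.\<close>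

lemma indep_info_noise:
  assumes k: "k < N"
  shows "indep_set (sets (info M e k)) (sets (noise M e k))"
proof -
  define E where "E i = {e i -` A \<inter> space M | A. A \<in> sets borel}" for i
  \<comment> \<open>Two blocks indexed by \<open>bool\<close>, matching the encoding of
    \<open>indep_set\<close>: \<open>True\<close> is the past, \<open>False\<close> the single
    period \<open>k\<close>.\<close>
  define I where "I = (\<lambda>b. if b then {..<k} else {k})"
  have "indep_sets E {..<N}"
    using returns_indep unfolding indep_vars_def2 E_def by auto
  then have "indep_sets E (\<Union>b\<in>UNIV. I b)"
    by (rule indep_sets_mono_index[rotated]) (use k in \<open>auto simp: I_def split: if_splits\<close>)
  moreover have "Int_stable (E i)" for i
  proof (unfold Int_stable_def E_def, clarsimp)
    fix A B :: "(real^'m) set" assume "A \<in> sets borel" "B \<in> sets borel"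
    then show "\<exists>C. e i -` A \<inter> space M \<inter> (e i -` B \<inter> space M) = e i -` C \<inter> space M \<and> C \<in> sets borel"
      by (intro exI[of _ "A \<inter> B"]) auto
  qed
  moreover have "disjoint_family_on I UNIV"
    by (auto simp: I_def disjoint_family_on_def)
  ultimately have ind: "indep_sets (\<lambda>b. sigma_sets (space M) (\<Union>i\<in>I b. E i)) UNIV"
    by (intro indep_sets_collect_sigma) auto
  have info: "sets (info M e k) = sigma_sets (space M) (\<Union>i\<in>I True. E i)"
    unfolding sets_info I_def E_def by (rule arg_cong[where f = "sigma_sets (space M)"]) auto
  have noise: "sets (noise M e k) \<subseteq> sigma_sets (space M) (\<Union>i\<in>I False. E i)"
    unfolding sets_noise I_def E_def by (intro subsetI sigma_sets.Basic) auto
  show ?thesis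
    unfolding indep_set_def
  proof (rule indep_sets_mono_sets[OF ind])
    show "(case b of True \<Rightarrow> sets (info M e k) | False \<Rightarrow> sets (noise M e k))
        \<subseteq> sigma_sets (space M) (\<Union>i\<in>I b. E i)" for b
      using info noise by (cases b) auto
  qed
qed

lemma indep_var_info_noise:
  assumes k: "k < N" and H: "H \<in> borel_measurable (info M e k)"
    and G: "G \<in> borel_measurable (noise M e k)"
  shows "indep_var borel H borel G"
proof -
  have 1: "{H -` A \<inter> space M | A. A \<in> sets borel} \<subseteq> sets (info M e k)"
    using measurable_sets[OF H] by (auto simp: space_info)
  have 2: "{G -` A \<inter> space M | A. A \<in> sets borel} \<subseteq> sets (noise M e k)"
    using measurable_sets[OF G] by (auto simp: space_noise)
  have 3: "sigma_sets (space M) {H -` A \<inter> space M | A. A \<in> sets borel} \<subseteq> sets (info M e k)"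
    using sets.sigma_sets_subset[OF 1] by (simp add: space_info)
  have 4: "sigma_sets (space M) {G -` A \<inter> space M | A. A \<in> sets borel} \<subseteq> sets (noise M e k)"
    using sets.sigma_sets_subset[OF 2] by (simp add: space_noise)
  have "random_variable borel H" "random_variable borel G"
    using measurable_from_subalg subalgebra_info[of k] subalgebra_noise[of k] k H G by auto
  moreover have "indep_set (sigma_sets (space M) {H -` A \<inter> space M | A. A \<in> sets borel})
      (sigma_sets (space M) {G -` A \<inter> space M | A. A \<in> sets borel})"
    unfolding indep_set_def
    by (rule indep_sets_mono_sets[OF indep_info_noise[OF k, unfolded indep_set_def]])
      (use 3 4 in \<open>simp split: bool.split\<close>)
  ultimately show ?thesis
    unfolding indep_var_eq by blast
qed

section \<open>Conditional expectation of products with an independent factor\<close>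

lemma indep_product_integrable:
  fixes G H :: "'a \<Rightarrow> real"
  assumes k: "k < N" and H: "H \<in> borel_measurable (info M e k)" "integrable M H"
    and G: "G \<in> borel_measurable (noise M e k)" "integrable M G"
  shows "integrable M (\<lambda>\<omega>. G \<omega> * H \<omega>)"
  using indep_var_integrable[OF indep_var_info_noise[OF k H(1) G(1)] H(2) G(2)]
  by (simp add: mult.commute)

text \<open>Tested on an event \<open>A\<close> known at time \<open>k\<close>: the indicator of
  \<open>A\<close> times \<open>H\<close> is still known at time \<open>k\<close>, hence independent
  of \<open>G\<close>, and the expectation of the product factors.\<close>

lemma cond_exp_indep_product:
  fixes G H :: "'a \<Rightarrow> real"
  assumes k: "k < N" and H: "H \<in> borel_measurable (info M e k)" "integrable M H"
    and G: "G \<in> borel_measurable (noise M e k)" "integrable M G"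
  shows "AE \<omega> in M. real_cond_exp M (info M e k) (\<lambda>\<omega>. G \<omega> * H \<omega>) \<omega> = (\<integral>\<omega>. G \<omega> \<partial>M) * H \<omega>"
proof -
  have sub: "subalgebra M (info M e k)" using k by (simp add: subalgebra_info)
  interpret finite_measure_subalgebra M "info M e k"
    by (unfold_locales) (rule sub)
  show ?thesis
  proof (rule real_cond_exp_charact)
    fix A assume A: "A \<in> sets (info M e k)"
    then have [measurable]: "A \<in> sets M" using sub by (auto simp: subalgebra_def)
    have HA: "(\<lambda>\<omega>. indicator A \<omega> * H \<omega>) \<in> borel_measurable (info M e k)"
      using A H(1) by measurable
    have HAi: "integrable M (\<lambda>\<omega>. indicator A \<omega> * H \<omega>)"
      using integrable_mult_indicator[OF \<open>A \<in> sets M\<close> H(2)] by simp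
    show "(\<integral>\<omega>\<in>A. (G \<omega> * H \<omega>) \<partial>M) = (\<integral>\<omega>\<in>A. ((\<integral>\<omega>. G \<omega> \<partial>M) * H \<omega>) \<partial>M)"
      using indep_var_lebesgue_integral[OF indep_var_info_noise[OF k HA G(1)] HAi G(2)]
      by (simp add: set_lebesgue_integral_def mult_ac)
  qed (use indep_product_integrable[OF assms] H in auto)
qed

text \<open>Vector version, needed because a deviation is a random vector paired with the excess
  return. The scalar case is applied along each basis vector and the finitely many null sets are
  merged.\<close>

lemma cond_exp_indep_inner:
  fixes G H :: "'a \<Rightarrow> 'b::euclidean_space"
  assumes k: "k < N" and H: "H \<in> borel_measurable (info M e k)" "integrable M H"
    and G: "G \<in> borel_measurable (noise M e k)" "integrable M G"
  shows "integrable M (\<lambda>\<omega>. G \<omega> \<bullet> H \<omega>)"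
    and "AE \<omega> in M. real_cond_exp M (info M e k) (\<lambda>\<omega>. G \<omega> \<bullet> H \<omega>) \<omega> = (\<integral>\<omega>. G \<omega> \<partial>M) \<bullet> H \<omega>"
proof -
  interpret finite_measure_subalgebra M "info M e k"
    by (unfold_locales) (use k in \<open>simp add: subalgebra_info\<close>)
  have GHi: "(\<lambda>\<omega>. H \<omega> \<bullet> i) \<in> borel_measurable (info M e k)" "integrable M (\<lambda>\<omega>. H \<omega> \<bullet> i)"
    "(\<lambda>\<omega>. G \<omega> \<bullet> i) \<in> borel_measurable (noise M e k)" "integrable M (\<lambda>\<omega>. G \<omega> \<bullet> i)" for i
    using H G by auto
  have int: "integrable M (\<lambda>\<omega>. (G \<omega> \<bullet> i) * (H \<omega> \<bullet> i))" for i
    by (rule indep_product_integrable[OF k GHi])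
  have eq: "(\<lambda>\<omega>. G \<omega> \<bullet> H \<omega>) = (\<lambda>\<omega>. \<Sum>i\<in>Basis. (G \<omega> \<bullet> i) * (H \<omega> \<bullet> i))"
    by (intro ext euclidean_inner)
  show "integrable M (\<lambda>\<omega>. G \<omega> \<bullet> H \<omega>)"
    unfolding eq using int by (rule Bochner_Integration.integrable_sum)
  have "AE \<omega> in M. real_cond_exp M (info M e k) (\<lambda>\<omega>. G \<omega> \<bullet> H \<omega>) \<omega>
      = (\<Sum>i\<in>Basis. real_cond_exp M (info M e k) (\<lambda>\<omega>. (G \<omega> \<bullet> i) * (H \<omega> \<bullet> i)) \<omega>)"
    unfolding eq by (rule real_cond_exp_sum) (rule int)
  moreover have "AE \<omega> in M. \<forall>i\<in>Basis.
      real_cond_exp M (info M e k) (\<lambda>\<omega>. (G \<omega> \<bullet> i) * (H \<omega> \<bullet> i)) \<omega>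
        = (\<integral>\<omega>. G \<omega> \<bullet> i \<partial>M) * (H \<omega> \<bullet> i)"
    using cond_exp_indep_product[OF k GHi] by (intro AE_finite_allI) auto
  ultimately show "AE \<omega> in M. real_cond_exp M (info M e k) (\<lambda>\<omega>. G \<omega> \<bullet> H \<omega>) \<omega>
      = (\<integral>\<omega>. G \<omega> \<partial>M) \<bullet> H \<omega>"
    by eventually_elim (subst euclidean_inner, simp add: G(2))
qed

text \<open>A deviation at time \<open>j\<close> is judged with the information at \<open>j\<close>
  but acts through all later periods \<open>k\<close>. The tower property conditions on time
  \<open>k\<close> first, where the mean of \<open>G\<close> comes out as a constant.\<close>

lemma cond_exp_indep_product_nested:
  fixes G H :: "'a \<Rightarrow> real"
  assumes j: "j \<le> k" and k: "k < N"
    and H: "H \<in> borel_measurable (info M e k)" "integrable M H"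
    and G: "G \<in> borel_measurable (noise M e k)" "integrable M G"
  shows "AE \<omega> in M. real_cond_exp M (info M e j) (\<lambda>\<omega>. G \<omega> * H \<omega>) \<omega>
    = (\<integral>\<omega>. G \<omega> \<partial>M) * real_cond_exp M (info M e j) H \<omega>"
proof -
  have subk: "subalgebra M (info M e k)" and subj: "subalgebra M (info M e j)"
    using j k by (simp_all add: subalgebra_info)
  interpret j: finite_measure_subalgebra M "info M e j" by (unfold_locales) (rule subj)
  interpret k: finite_measure_subalgebra M "info M e k" by (unfold_locales) (rule subk)
  let ?GH = "\<lambda>\<omega>. G \<omega> * H \<omega>"
  have int: "integrable M ?GH" by (rule indep_product_integrable[OF k H G])
  have "AE \<omega> in M. real_cond_exp M (info M e j) (real_cond_exp M (info M e k) ?GH) \<omega>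
      = real_cond_exp M (info M e j) ?GH \<omega>"
    by (rule j.real_cond_exp_nested_subalg[OF subk subalgebra_info_mono[OF j] int])
  moreover have "AE \<omega> in M. real_cond_exp M (info M e j) (real_cond_exp M (info M e k) ?GH) \<omega>
      = real_cond_exp M (info M e j) (\<lambda>\<omega>. (\<integral>\<omega>. G \<omega> \<partial>M) * H \<omega>) \<omega>"
    by (rule j.real_cond_exp_cong[OF cond_exp_indep_product[OF k H G]]) (use H in auto)
  moreover have "AE \<omega> in M. real_cond_exp M (info M e j) (\<lambda>\<omega>. (\<integral>\<omega>. G \<omega> \<partial>M) * H \<omega>) \<omega>
      = (\<integral>\<omega>. G \<omega> \<partial>M) * real_cond_exp M (info M e j) H \<omega>"
    by (rule j.real_cond_exp_cmult) (rule H)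
  ultimately show ?thesis by eventually_elim simp
qed

text \<open>A product of square-integrable functions is in general only integrable; here
  independence lets the expectation of the product of squared norms factor. This keeps wealth
  square-integrable from one period to the next.\<close>

lemma L2_indep_inner:
  fixes G H :: "'a \<Rightarrow> 'b::euclidean_space"
  assumes k: "k < N" and G: "G \<in> L2 M (noise M e k)" and H: "H \<in> L2 M (info M e k)"
  shows "(\<lambda>\<omega>. G \<omega> \<bullet> H \<omega>) \<in> L2 M (info M e (Suc k))"
proof (rule L2_dominated)
  show sub: "subalgebra M (info M e (Suc k))" using k by (simp add: subalgebra_info)
  show "integrable M (\<lambda>\<omega>. (norm (G \<omega>))\<^sup>2 * (norm (H \<omega>))\<^sup>2)"
    using G H by (intro indep_product_integrable[OF k]) (auto simp: L2_def)
  have "G \<in> L2 M (info M e (Suc k))"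
    by (rule L2_subalgebra_mono[OF subalgebra_info_noise G]) simp
  moreover have "H \<in> L2 M (info M e (Suc k))"
    by (rule L2_subalgebra_mono[OF subalgebra_info_mono H]) simp
  ultimately show "(\<lambda>\<omega>. G \<omega> \<bullet> H \<omega>) \<in> borel_measurable (info M e (Suc k))"
    unfolding L2_def by (intro borel_measurable_inner) simp_all
  show "(norm (G \<omega> \<bullet> H \<omega>))\<^sup>2 \<le> (norm (G \<omega>))\<^sup>2 * (norm (H \<omega>))\<^sup>2" for \<omega>
    using Cauchy_Schwarz_ineq2[of "G \<omega>" "H \<omega>"]
      power_mono[of "\<bar>G \<omega> \<bullet> H \<omega>\<bar>" "norm (G \<omega>) * norm (H \<omega>)" 2]
    by (simp add: power_mult_distrib)
qed

section \<open>Moments of the excess return\<close>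

lemma excess_L2:
  assumes k: "k < N"
  shows "excess s e k \<in> L2 M (noise M e k)"
proof -
  have "e k \<in> borel_measurable (noise M e k)"
    unfolding noise_def by (rule measurable_vimage_algebra1) simp
  then have "e k \<in> L2 M (noise M e k)"
    using returns_square_integrable[OF k] by (simp add: L2_def)
  then have "(\<lambda>\<omega>. e k \<omega> - (\<chi> i. s k)) \<in> L2 M (noise M e k)"
    by (rule L2_diff[OF subalgebra_noise[OF k] _ L2_const])
  moreover have "excess s e k = (\<lambda>\<omega>. e k \<omega> - (\<chi> i. s k))"
    by (simp add: excess_def fun_eq_iff vec_eq_iff)
  ultimately show ?thesis by simp
qed

lemma excess_inner_L2: "k < N \<Longrightarrow> (\<lambda>\<omega>. excess s e k \<omega> \<bullet> a) \<in> L2 M (noise M e k)"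
  by (rule L2_linear[OF subalgebra_noise excess_L2 bounded_linear_inner_left])

lemma excess_integrable: "k < N \<Longrightarrow> integrable M (excess s e k)"
  by (rule L2_integrable[OF subalgebra_noise excess_L2])

lemma excess_second_moment:
  assumes k: "k < N"
  defines "m \<equiv> \<integral>\<omega>. excess s e k \<omega> \<partial>M"
  shows "(\<integral>\<omega>. (excess s e k \<omega> \<bullet> a) * (excess s e k \<omega> \<bullet> b) \<partial>M)
    = (a v* covariance_matrix M (excess s e k)) \<bullet> b + (m \<bullet> a) * (m \<bullet> b)"
proof -
  note sub = subalgebra_noise[OF k]
  have "excess s e k \<in> L2 M M"
    using L2_subalgebra_mono[OF sub excess_L2[OF k]] .
  then have "(a v* covariance_matrix M (excess s e k)) \<bullet> b
      = (\<integral>\<omega>. ((excess s e k \<omega> - m) \<bullet> a) * ((excess s e k \<omega> - m) \<bullet> b) \<partial>M)"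
    unfolding m_def by (rule covariance_bilinear[OF finite_measure_axioms])
  also have "\<dots> = (\<integral>\<omega>. (excess s e k \<omega> \<bullet> a) * (excess s e k \<omega> \<bullet> b)
      - (m \<bullet> a) * (excess s e k \<omega> \<bullet> b) - (m \<bullet> b) * (excess s e k \<omega> \<bullet> a)
      + (m \<bullet> a) * (m \<bullet> b) \<partial>M)"
    by (simp add: inner_diff_left algebra_simps)
  also have "\<dots> = (\<integral>\<omega>. (excess s e k \<omega> \<bullet> a) * (excess s e k \<omega> \<bullet> b) \<partial>M) - (m \<bullet> a) * (m \<bullet> b)"
    using L2_mult_integrable[OF sub excess_inner_L2[OF k] excess_inner_L2[OF k], of a b]
      excess_integrable[OF k]
    by (simp add: m_def prob_space)
  finally show ?thesis by simp
qed

abbreviation mean :: "nat \<Rightarrow> real^'m" where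
  "mean k \<equiv> \<integral>\<omega>. excess s e k \<omega> \<partial>M"

abbreviation cov :: "nat \<Rightarrow> real^'m^'m" where
  "cov k \<equiv> covariance_matrix M (excess s e k)"

section \<open>One period of an affine wealth recursion\<close>

lemma affine_noise_L2:
  assumes k: "k < N"
  shows "(\<lambda>\<omega>. c + excess s e k \<omega> \<bullet> a) \<in> L2 M (noise M e k)"
  by (rule L2_add[OF subalgebra_noise[OF k] L2_const excess_inner_L2[OF k]])

lemma L2_noise_mult:
  fixes f g :: "'a \<Rightarrow> real"
  assumes k: "k < N" and "f \<in> L2 M (noise M e k)" "g \<in> L2 M (noise M e k)"
  shows "(\<lambda>\<omega>. f \<omega> * g \<omega>) \<in> borel_measurable (noise M e k)"
    and "integrable M (\<lambda>\<omega>. f \<omega> * g \<omega>)"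
  using L2_mult_integrable[OF subalgebra_noise[OF k] assms(2,3)] assms
  by (auto simp: L2_def)

lemma excess_L2_info: "k < N \<Longrightarrow> excess s e k \<in> L2 M (info M e (Suc k))"
  by (rule L2_subalgebra_mono[OF subalgebra_info_noise[OF lessI] excess_L2])

text \<open>One shape covers both processes of the argument: the equilibrium wealth, and its
  perturbation as the case \<open>b = 0\<close>.\<close>

lemma affine_step_L2:
  assumes k: "k < N" and X: "X \<in> L2 M (info M e k)"
  shows "(\<lambda>\<omega>. (c + excess s e k \<omega> \<bullet> a) * X \<omega> + excess s e k \<omega> \<bullet> b) \<in> L2 M (info M e (Suc k))"
proof (rule L2_add)
  show sub: "subalgebra M (info M e (Suc k))" using k by (simp add: subalgebra_info)
  show "(\<lambda>\<omega>. (c + excess s e k \<omega> \<bullet> a) * X \<omega>) \<in> L2 M (info M e (Suc k))"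
    using L2_indep_inner[OF k affine_noise_L2[OF k] X] by simp
  show "(\<lambda>\<omega>. excess s e k \<omega> \<bullet> b) \<in> L2 M (info M e (Suc k))"
    by (rule L2_linear[OF sub excess_L2_info[OF k] bounded_linear_inner_left])
qed

text \<open>The covariance form is written with \<open>b\<close> on the left, so that a feedback
  vector put in for \<open>b\<close> appears as the row \<open>\<Phi> k v* cov k\<close> of the
  backward recursions.\<close>

lemma expectation_affine_product:
  assumes k: "k < N"
  shows "(\<integral>\<omega>. (c + excess s e k \<omega> \<bullet> a) * (d + excess s e k \<omega> \<bullet> b) \<partial>M)
    = (c + mean k \<bullet> a) * (d + mean k \<bullet> b) + (b v* cov k) \<bullet> a"
proof -
  have "(\<integral>\<omega>. (c + excess s e k \<omega> \<bullet> a) * (d + excess s e k \<omega> \<bullet> b) \<partial>M)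
     = (\<integral>\<omega>. c * d + c * (excess s e k \<omega> \<bullet> b) + d * (excess s e k \<omega> \<bullet> a)
        + (excess s e k \<omega> \<bullet> b) * (excess s e k \<omega> \<bullet> a) \<partial>M)"
    by (simp add: algebra_simps)
  also have "\<dots> = c * d + c * (mean k \<bullet> b) + d * (mean k \<bullet> a)
        + ((b v* cov k) \<bullet> a + (mean k \<bullet> b) * (mean k \<bullet> a))"
    using excess_integrable[OF k] L2_noise_mult(2)[OF k excess_inner_L2[OF k] excess_inner_L2[OF k]]
    by (simp add: prob_space excess_second_moment[OF k])
  finally show ?thesis by (simp add: algebra_simps)
qed

lemma cond_exp_affine_step:
  assumes j: "j \<le> k" and k: "k < N" and X: "X \<in> L2 M (info M e k)"
  shows "AE \<omega> in M. real_cond_exp M (info M e j)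
      (\<lambda>\<omega>. (c + excess s e k \<omega> \<bullet> a) * X \<omega> + excess s e k \<omega> \<bullet> b) \<omega>
    = (c + mean k \<bullet> a) * real_cond_exp M (info M e j) X \<omega> + mean k \<bullet> b"
proof -
  have subj: "subalgebra M (info M e j)" and subk: "subalgebra M (info M e k)"
    using j k by (simp_all add: subalgebra_info)
  interpret finite_measure_subalgebra M "info M e j" by unfold_locales (rule subj)
  let ?E = "real_cond_exp M (info M e j)"
  note nested = cond_exp_indep_product_nested[OF j k]
  have 1: "AE \<omega> in M. ?E (\<lambda>\<omega>. (c + excess s e k \<omega> \<bullet> a) * X \<omega>) \<omega>
      = (\<integral>\<omega>. c + excess s e k \<omega> \<bullet> a \<partial>M) * ?E X \<omega>"
    using X L2_integrable[OF subk X] affine_noise_L2[OF k]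
      L2_integrable[OF subalgebra_noise[OF k] affine_noise_L2[OF k]]
    by (intro nested) (auto simp: L2_def)
  \<comment> \<open>The additive noise is read as a product with the constant 1, so that the same
    factorisation applies to it.\<close>
  have 2: "AE \<omega> in M. ?E (\<lambda>\<omega>. (excess s e k \<omega> \<bullet> b) * 1) \<omega>
      = (\<integral>\<omega>. excess s e k \<omega> \<bullet> b \<partial>M) * ?E (\<lambda>_. 1) \<omega>"
    using excess_inner_L2[OF k] L2_integrable[OF subalgebra_noise[OF k] excess_inner_L2[OF k]]
    by (intro nested) (auto simp: L2_def)
  have 3: "AE \<omega> in M. ?E (\<lambda>_. 1) \<omega> = 1"
    by (rule real_cond_exp_F_meas) auto
  have 4: "AE \<omega> in M. ?E (\<lambda>\<omega>. (c + excess s e k \<omega> \<bullet> a) * X \<omega> + excess s e k \<omega> \<bullet> b) \<omega>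
      = ?E (\<lambda>\<omega>. (c + excess s e k \<omega> \<bullet> a) * X \<omega>) \<omega> + ?E (\<lambda>\<omega>. excess s e k \<omega> \<bullet> b) \<omega>"
  proof (rule real_cond_exp_add)
    show "integrable M (\<lambda>\<omega>. (c + excess s e k \<omega> \<bullet> a) * X \<omega>)"
      using L2_integrable[OF subalgebra_info affine_step_L2[OF k X, of c a 0]] k by simp
  qed (use excess_integrable[OF k] in simp)
  from 1 2 3 4 show ?thesis
    by eventually_elim (use excess_integrable[OF k] in \<open>simp add: prob_space\<close>)
qed

text \<open>Expanding the product separates factors depending only on the noise of period
  \<open>k\<close> from \<open>X * Y\<close> and \<open>Y\<close>, which are known at time
  \<open>k\<close>; each noise factor then leaves as its mean.\<close>

lemma cond_exp_affine_step_product: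
  assumes j: "j \<le> k" and k: "k < N"
    and X: "X \<in> L2 M (info M e k)" and Y: "Y \<in> L2 M (info M e k)"
  shows "AE \<omega> in M. real_cond_exp M (info M e j)
      (\<lambda>\<omega>. ((c + excess s e k \<omega> \<bullet> a) * X \<omega> + excess s e k \<omega> \<bullet> b)
        * ((d + excess s e k \<omega> \<bullet> f) * Y \<omega>)) \<omega>
    = ((c + mean k \<bullet> a) * (d + mean k \<bullet> f) + (f v* cov k) \<bullet> a)
        * real_cond_exp M (info M e j) (\<lambda>\<omega>. X \<omega> * Y \<omega>) \<omega>
      + ((mean k \<bullet> b) * (d + mean k \<bullet> f) + (f v* cov k) \<bullet> b)
        * real_cond_exp M (info M e j) Y \<omega>"
proof -
  have subj: "subalgebra M (info M e j)" and subk: "subalgebra M (info M e k)"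
    using j k by (simp_all add: subalgebra_info)
  interpret finite_measure_subalgebra M "info M e j" by unfold_locales (rule subj)
  let ?E = "real_cond_exp M (info M e j)"
  let ?A = "\<lambda>\<omega>. (c + excess s e k \<omega> \<bullet> a) * (d + excess s e k \<omega> \<bullet> f)"
  \<comment> \<open>The summand 0 makes this factor another instance of the affine form, so both
    noise factors are treated by the same lemmas.\<close>
  let ?B = "\<lambda>\<omega>. (0 + excess s e k \<omega> \<bullet> b) * (d + excess s e k \<omega> \<bullet> f)"
  note A = L2_noise_mult[OF k affine_noise_L2[OF k] affine_noise_L2[OF k]]
  have [measurable]: "X \<in> borel_measurable (info M e k)" "Y \<in> borel_measurable (info M e k)"
    using X Y by (auto simp: L2_def)
  have XY: "(\<lambda>\<omega>. X \<omega> * Y \<omega>) \<in> borel_measurable (info M e k)" "integrable M (\<lambda>\<omega>. X \<omega> * Y \<omega>)"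
    "Y \<in> borel_measurable (info M e k)" "integrable M Y"
    using L2_mult_integrable[OF subk X Y] L2_integrable[OF subk Y] by auto
  have "AE \<omega> in M. ?E (\<lambda>\<omega>. ?A \<omega> * (X \<omega> * Y \<omega>) + ?B \<omega> * Y \<omega>) \<omega>
      = ?E (\<lambda>\<omega>. ?A \<omega> * (X \<omega> * Y \<omega>)) \<omega> + ?E (\<lambda>\<omega>. ?B \<omega> * Y \<omega>) \<omega>"
    by (intro real_cond_exp_add indep_product_integrable[OF k] A XY)
  moreover have "AE \<omega> in M. ?E (\<lambda>\<omega>. ?A \<omega> * (X \<omega> * Y \<omega>)) \<omega>
      = (\<integral>\<omega>. ?A \<omega> \<partial>M) * ?E (\<lambda>\<omega>. X \<omega> * Y \<omega>) \<omega>"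
    by (intro cond_exp_indep_product_nested[OF j k] A XY)
  moreover have "AE \<omega> in M. ?E (\<lambda>\<omega>. ?B \<omega> * Y \<omega>) \<omega> = (\<integral>\<omega>. ?B \<omega> \<partial>M) * ?E Y \<omega>"
    by (intro cond_exp_indep_product_nested[OF j k] A XY)
  ultimately have "AE \<omega> in M. ?E (\<lambda>\<omega>. ?A \<omega> * (X \<omega> * Y \<omega>) + ?B \<omega> * Y \<omega>) \<omega>
      = (\<integral>\<omega>. ?A \<omega> \<partial>M) * ?E (\<lambda>\<omega>. X \<omega> * Y \<omega>) \<omega> + (\<integral>\<omega>. ?B \<omega> \<partial>M) * ?E Y \<omega>"
    by eventually_elim (simp only:)
  moreover have "(\<lambda>\<omega>. ((c + excess s e k \<omega> \<bullet> a) * X \<omega> + excess s e k \<omega> \<bullet> b)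
        * ((d + excess s e k \<omega> \<bullet> f) * Y \<omega>)) = (\<lambda>\<omega>. ?A \<omega> * (X \<omega> * Y \<omega>) + ?B \<omega> * Y \<omega>)"
    by (simp add: algebra_simps)
  ultimately show ?thesis
    by (simp only: expectation_affine_product[OF k]
        expectation_affine_product[OF k, of 0, unfolded add_0] add_0)
qed

text \<open>The expectation stays a vector because it will be paired with a random deviation; its
  inner product with any fixed \<open>z\<close> is evaluated so that \<open>z\<close> can be
  replaced pointwise by that deviation.\<close>

lemma expectation_affine_excess_inner:
  assumes k: "k < N"
  shows "integrable M (\<lambda>\<omega>. (c + excess s e k \<omega> \<bullet> a) *\<^sub>R excess s e k \<omega>)"
    and "(\<integral>\<omega>. (c + excess s e k \<omega> \<bullet> a) *\<^sub>R excess s e k \<omega> \<partial>M) \<bullet> z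
      = (c + mean k \<bullet> a) * (mean k \<bullet> z) + (z v* cov k) \<bullet> a"
proof -
  show int: "integrable M (\<lambda>\<omega>. (c + excess s e k \<omega> \<bullet> a) *\<^sub>R excess s e k \<omega>)"
    by (rule L2_scaleR_integrable[OF subalgebra_noise[OF k] affine_noise_L2[OF k] excess_L2[OF k]])
  show "(\<integral>\<omega>. (c + excess s e k \<omega> \<bullet> a) *\<^sub>R excess s e k \<omega> \<partial>M) \<bullet> z
      = (c + mean k \<bullet> a) * (mean k \<bullet> z) + (z v* cov k) \<bullet> a"
    using expectation_affine_product[OF k, of c a 0 z]
    by (simp add: integral_inner_left[symmetric] int del: integral_inner_left)
qed

text \<open>The period of the deviation itself: \<open>h\<close> is random, so
  \<open>excess s e k \<omega> \<bullet> h \<omega>\<close> lacks the deterministic coefficients of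
  an affine step. Since \<open>h\<close> is known at time \<open>k\<close>, conditioning at that
  time acts on the excess return alone.\<close>

lemma cond_exp_excess_inner:
  assumes k: "k < N" and h: "h \<in> L2 M (info M e k)" and X: "X \<in> L2 M (info M e k)"
  shows "(\<lambda>\<omega>. excess s e k \<omega> \<bullet> h \<omega>) \<in> L2 M (info M e (Suc k))"
    and "AE \<omega> in M. real_cond_exp M (info M e k) (\<lambda>\<omega>. excess s e k \<omega> \<bullet> h \<omega>) \<omega> = mean k \<bullet> h \<omega>"
    and "AE \<omega> in M. real_cond_exp M (info M e k)
        (\<lambda>\<omega>. ((c + excess s e k \<omega> \<bullet> a) * X \<omega> + excess s e k \<omega> \<bullet> b)
          * (excess s e k \<omega> \<bullet> h \<omega>)) \<omega>
      = ((c + mean k \<bullet> a) * (mean k \<bullet> h \<omega>) + (h \<omega> v* cov k) \<bullet> a) * X \<omega>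
        + ((mean k \<bullet> b) * (mean k \<bullet> h \<omega>) + (h \<omega> v* cov k) \<bullet> b)"
proof -
  have sub: "subalgebra M (info M e k)" using k by (simp add: subalgebra_info)
  interpret finite_measure_subalgebra M "info M e k" by unfold_locales (rule sub)
  show "(\<lambda>\<omega>. excess s e k \<omega> \<bullet> h \<omega>) \<in> L2 M (info M e (Suc k))"
    by (rule L2_indep_inner[OF k excess_L2[OF k] h])
  have hm: "h \<in> borel_measurable (info M e k)" "integrable M h"
    using h L2_integrable[OF sub h] by (auto simp: L2_def)
  have Xhm: "(\<lambda>\<omega>. X \<omega> *\<^sub>R h \<omega>) \<in> borel_measurable (info M e k)" "integrable M (\<lambda>\<omega>. X \<omega> *\<^sub>R h \<omega>)"
    using h X L2_scaleR_integrable[OF sub X h] by (auto simp: L2_def)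
  have Om: "excess s e k \<in> borel_measurable (noise M e k)"
    using excess_L2[OF k] by (simp add: L2_def)
  show "AE \<omega> in M. real_cond_exp M (info M e k) (\<lambda>\<omega>. excess s e k \<omega> \<bullet> h \<omega>) \<omega> = mean k \<bullet> h \<omega>"
    by (rule cond_exp_indep_inner(2)[OF k hm Om excess_integrable[OF k]])
  \<comment> \<open>Attaching the scalar noise factor to the excess return gives a pure noise
    vector, paired with \<open>X \<omega> *\<^sub>R h \<omega>\<close> or \<open>h \<omega>\<close>,
    both known at time \<open>k\<close>.\<close>
  let ?G = "\<lambda>c a \<omega>. (c + excess s e k \<omega> \<bullet> a) *\<^sub>R excess s e k \<omega>"
  have G: "?G c a \<in> borel_measurable (noise M e k)" "integrable M (?G c a)" for c a
    using Om affine_noise_L2[OF k] expectation_affine_excess_inner(1)[OF k] by (auto simp: L2_def)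
  have "AE \<omega> in M. real_cond_exp M (info M e k)
        (\<lambda>\<omega>. ?G c a \<omega> \<bullet> (X \<omega> *\<^sub>R h \<omega>) + ?G 0 b \<omega> \<bullet> h \<omega>) \<omega>
      = real_cond_exp M (info M e k) (\<lambda>\<omega>. ?G c a \<omega> \<bullet> (X \<omega> *\<^sub>R h \<omega>)) \<omega>
        + real_cond_exp M (info M e k) (\<lambda>\<omega>. ?G 0 b \<omega> \<bullet> h \<omega>) \<omega>"
    by (rule real_cond_exp_add[OF cond_exp_indep_inner(1)[OF k Xhm G]
          cond_exp_indep_inner(1)[OF k hm G]])
  moreover note cond_exp_indep_inner(2)[OF k Xhm G, of c a]
    cond_exp_indep_inner(2)[OF k hm G, of 0 b]
  ultimately have "AE \<omega> in M. real_cond_exp M (info M e k)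
        (\<lambda>\<omega>. ?G c a \<omega> \<bullet> (X \<omega> *\<^sub>R h \<omega>) + ?G 0 b \<omega> \<bullet> h \<omega>) \<omega>
      = ((c + mean k \<bullet> a) * (mean k \<bullet> h \<omega>) + (h \<omega> v* cov k) \<bullet> a) * X \<omega>
        + ((mean k \<bullet> b) * (mean k \<bullet> h \<omega>) + (h \<omega> v* cov k) \<bullet> b)"
    by eventually_elim
      (simp only: inner_scaleR_right expectation_affine_excess_inner(2)[OF k]
        expectation_affine_excess_inner(2)[OF k, of 0, unfolded add_0] add_0 mult.commute)
  moreover have "(\<lambda>\<omega>. ((c + excess s e k \<omega> \<bullet> a) * X \<omega> + excess s e k \<omega> \<bullet> b)
          * (excess s e k \<omega> \<bullet> h \<omega>)) = (\<lambda>\<omega>. ?G c a \<omega> \<bullet> (X \<omega> *\<^sub>R h \<omega>) + ?G 0 b \<omega> \<bullet> h \<omega>)"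
    by (simp add: algebra_simps)
  ultimately show "AE \<omega> in M. real_cond_exp M (info M e k)
        (\<lambda>\<omega>. ((c + excess s e k \<omega> \<bullet> a) * X \<omega> + excess s e k \<omega> \<bullet> b)
          * (excess s e k \<omega> \<bullet> h \<omega>)) \<omega>
      = ((c + mean k \<bullet> a) * (mean k \<bullet> h \<omega>) + (h \<omega> v* cov k) \<bullet> a) * X \<omega>
        + ((mean k \<bullet> b) * (mean k \<bullet> h \<omega>) + (h \<omega> v* cov k) \<bullet> b)"
    by (simp only:)
qed

section \<open>The first-order condition by a backward invariant\<close>

text \<open>\<open>P\<close> and \<open>Q\<close> stand for the sums \<open>S + T\<close> and
  \<open>\<S> + \<T>\<close>. The stationarity equations are required for every \<open>z\<close>
  because they are applied pointwise to the random deviation \<open>h\<close>. \<open>D\<close> is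
  described from \<open>Suc k\<close> on, the first time at which the deviation is felt.\<close>

lemma first_order_condition:
  fixes X D :: "nat \<Rightarrow> 'a \<Rightarrow> real" and P Q U \<pi> :: "nat \<Rightarrow> real"
    and a b \<Phi> :: "nat \<Rightarrow> real^'m" and h :: "'a \<Rightarrow> real^'m"
  assumes k: "k < N" and Xk: "X k \<in> L2 M (info M e k)" and h: "h \<in> L2 M (info M e k)"
    and X_step: "\<And>l. k \<le> l \<Longrightarrow> l < N \<Longrightarrow> X (Suc l)
      = (\<lambda>\<omega>. (s l - excess s e l \<omega> \<bullet> a l) * X l \<omega> - excess s e l \<omega> \<bullet> b l)"
    and D_start: "D (Suc k) = (\<lambda>\<omega>. excess s e k \<omega> \<bullet> h \<omega>)"
    and D_step: "\<And>l. k < l \<Longrightarrow> l < N \<Longrightarrow> D (Suc l) = (\<lambda>\<omega>. (s l + excess s e l \<omega> \<bullet> \<Phi> l) * D l \<omega>)"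
    and P_rec: "\<And>l. l < N \<Longrightarrow> P l = P (Suc l)
      * ((s l + mean l \<bullet> \<Phi> l) * (s l - mean l \<bullet> a l) - (\<Phi> l v* cov l) \<bullet> a l)"
    and Q_rec: "\<And>l. l < N \<Longrightarrow> Q l = Q (Suc l) * (s l + mean l \<bullet> \<Phi> l) * (s l - mean l \<bullet> a l)
      - P (Suc l) * ((\<Phi> l v* cov l) \<bullet> a l)"
    and U_rec: "\<And>l. l < N \<Longrightarrow> U l = (s l + mean l \<bullet> \<Phi> l) * U (Suc l)"
    and \<pi>_rec: "\<And>l. l < N \<Longrightarrow> \<pi> l = (s l + mean l \<bullet> \<Phi> l) * \<pi> (Suc l)
      - Q (Suc l) * (s l + mean l \<bullet> \<Phi> l) * (mean l \<bullet> b l)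
      - P (Suc l) * ((\<Phi> l v* cov l) \<bullet> b l)"
    and P_N: "P N = 1" and Q_N: "Q N = 0"
    and stationary_a: "\<And>z. Q (Suc k) * (mean k \<bullet> a k) * (mean k \<bullet> z)
      + P (Suc k) * ((z v* cov k) \<bullet> a k) = (s k * Q (Suc k) + U (Suc k)) * (mean k \<bullet> z)"
    and stationary_b: "\<And>z. Q (Suc k) * (mean k \<bullet> b k) * (mean k \<bullet> z)
      + P (Suc k) * ((z v* cov k) \<bullet> b k) = \<pi> (Suc k) * (mean k \<bullet> z)"
  defines "E \<equiv> real_cond_exp M (info M e k)"
  shows "X N \<in> L2 M (info M e N)" and "D N \<in> L2 M (info M e N)"
    and "AE \<omega> in M. 2 * (E (\<lambda>\<omega>. X N \<omega> * D N \<omega>) \<omega> - E (X N) \<omega> * E (D N) \<omega>)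
      = - 2 * (U N * X k \<omega> + \<pi> N) * E (D N) \<omega>"
proof -
  have sub: "subalgebra M (info M e k)" using k by (simp add: subalgebra_info)
  interpret finite_measure_subalgebra M "info M e k" by unfold_locales (rule sub)
  \<comment> \<open>Signs are absorbed into the coefficients, so that both recursions are literal
    affine steps.\<close>
  have X_step': "X (Suc l) = (\<lambda>\<omega>. (s l + excess s e l \<omega> \<bullet> (- a l)) * X l \<omega> + excess s e l \<omega> \<bullet> (- b l))"
    if "k \<le> l" "l < N" for l
    using X_step[OF that] by simp
  have D_step': "D (Suc l) = (\<lambda>\<omega>. (s l + excess s e l \<omega> \<bullet> \<Phi> l) * D l \<omega> + excess s e l \<omega> \<bullet> 0)"
    if "k < l" "l < N" for l
    using D_step[OF that] by simp
  have XL: "X l \<in> L2 M (info M e l)" if "k \<le> l" "l \<le> N" for l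
    using that
  proof (induction rule: dec_induct)
    case (step l)
    then show ?case by (simp only: X_step' affine_step_L2)
  qed (rule Xk)
  have DL: "D l \<in> L2 M (info M e l)" if "Suc k \<le> l" "l \<le> N" for l
    using that
  proof (induction rule: dec_induct)
    case base
    show ?case unfolding D_start by (rule cond_exp_excess_inner(1)[OF k h Xk])
  next
    case (step l)
    then have "k < l" "l < N" by auto
    with step show ?case by (simp only: D_step' affine_step_L2)
  qed
  show XN: "X N \<in> L2 M (info M e N)" and DN: "D N \<in> L2 M (info M e N)"
    using XL[of N] DL[of N] k by auto
  have EX: "AE \<omega> in M. E (X (Suc l)) \<omega> = (s l - mean l \<bullet> a l) * E (X l) \<omega> - mean l \<bullet> b l"
    if "k \<le> l" "l < N" for l
    using cond_exp_affine_step[OF that XL, of "s l" "- a l" "- b l"] that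
    by (simp add: X_step' E_def)
  \<comment> \<open>\<open>P\<close> weighs the conditional covariance, \<open>Q\<close> the product
    of the conditional means. The weight on \<open>E (D l)\<close> contains \<open>X k\<close>, not
    \<open>X l\<close>, since the cost uses the wealth at the time of the decision.\<close>
  have invariant: "AE \<omega> in M. P l * (E (\<lambda>\<omega>. X l \<omega> * D l \<omega>) \<omega> - E (X l) \<omega> * E (D l) \<omega>)
      + Q l * E (X l) \<omega> * E (D l) \<omega> + (\<pi> l + U l * X k \<omega>) * E (D l) \<omega> = 0"
    if "Suc k \<le> l" "l \<le> N" for l
    using that
  proof (induction rule: dec_induct)
    case base
    have "AE \<omega> in M. E (X k) \<omega> = X k \<omega>"
      unfolding E_def using Xk L2_integrable[OF sub Xk]
      by (intro real_cond_exp_F_meas) (auto simp: L2_def)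
    moreover note EX[OF order_refl k]
    moreover have "AE \<omega> in M. E (D (Suc k)) \<omega> = mean k \<bullet> h \<omega>"
      unfolding E_def D_start by (rule cond_exp_excess_inner(2)[OF k h Xk])
    moreover have "AE \<omega> in M. E (\<lambda>\<omega>. X (Suc k) \<omega> * D (Suc k) \<omega>) \<omega>
      = ((s k - mean k \<bullet> a k) * (mean k \<bullet> h \<omega>) - (h \<omega> v* cov k) \<bullet> a k) * X k \<omega>
        - ((mean k \<bullet> b k) * (mean k \<bullet> h \<omega>) + (h \<omega> v* cov k) \<bullet> b k)"
      using cond_exp_excess_inner(3)[OF k h Xk, of "s k" "- a k" "- b k"]
      unfolding E_def D_start by (simp add: X_step[OF order_refl k] algebra_simps)
    ultimately show ?case
    proof eventually_elim
      case (elim \<omega>)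
      \<comment> \<open>Sorted by powers of \<open>X k\<close>, the coefficient of
        \<open>X k\<close> and the remaining term are the defects of the two stationarity equations
        at \<open>z = h \<omega>\<close>.\<close>
      have "P (Suc k) * (E (\<lambda>\<omega>. X (Suc k) \<omega> * D (Suc k) \<omega>) \<omega> - E (X (Suc k)) \<omega> * E (D (Suc k)) \<omega>)
          + Q (Suc k) * E (X (Suc k)) \<omega> * E (D (Suc k)) \<omega>
          + (\<pi> (Suc k) + U (Suc k) * X k \<omega>) * E (D (Suc k)) \<omega>
        = X k \<omega> * ((s k * Q (Suc k) + U (Suc k)) * (mean k \<bullet> h \<omega>)
            - (Q (Suc k) * (mean k \<bullet> a k) * (mean k \<bullet> h \<omega>) + P (Suc k) * ((h \<omega> v* cov k) \<bullet> a k)))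
          + (\<pi> (Suc k) * (mean k \<bullet> h \<omega>)
            - (Q (Suc k) * (mean k \<bullet> b k) * (mean k \<bullet> h \<omega>) + P (Suc k) * ((h \<omega> v* cov k) \<bullet> b k)))"
        unfolding elim by (simp only: algebra_simps)
      then show ?case
        unfolding stationary_a stationary_b by simp
    qed
  next
    case (step l)
    then have l: "k < l" "l < N" by auto
    have kl: "k \<le> l" using l by simp
    have "AE \<omega> in M. E (D (Suc l)) \<omega> = (s l + mean l \<bullet> \<Phi> l) * E (D l) \<omega>"
      using cond_exp_affine_step[OF kl l(2) DL, of "s l" "\<Phi> l" 0] l
      by (simp add: D_step E_def)
    moreover have "AE \<omega> in M. E (\<lambda>\<omega>. X (Suc l) \<omega> * D (Suc l) \<omega>) \<omega>
      = ((s l + mean l \<bullet> \<Phi> l) * (s l - mean l \<bullet> a l) - (\<Phi> l v* cov l) \<bullet> a l)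
          * E (\<lambda>\<omega>. X l \<omega> * D l \<omega>) \<omega>
        - ((s l + mean l \<bullet> \<Phi> l) * (mean l \<bullet> b l) + (\<Phi> l v* cov l) \<bullet> b l) * E (D l) \<omega>"
      using cond_exp_affine_step_product[OF kl l(2) XL DL, of "s l" "- a l" "- b l" "s l" "\<Phi> l"] l
      by (simp add: D_step X_step E_def algebra_simps)
    moreover note EX[OF kl l(2)] step.IH[OF l(2)[THEN less_imp_le]]
    ultimately show ?case
    proof eventually_elim
      case (elim \<omega>)
      \<comment> \<open>Compare coefficients of the conditional covariance, of
        \<open>E (X l) * E (D l)\<close> and of \<open>E (D l)\<close>. The noise of period
        \<open>l\<close> adds covariance terms weighted by \<open>P (Suc l)\<close>; they also
        multiply the product of means and \<open>E (D l)\<close>, which explains the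
        \<open>P\<close> terms in the recursions of \<open>Q\<close> and
        \<open>\<pi>\<close>.\<close>
      have "P (Suc l) * (E (\<lambda>\<omega>. X (Suc l) \<omega> * D (Suc l) \<omega>) \<omega> - E (X (Suc l)) \<omega> * E (D (Suc l)) \<omega>)
          + Q (Suc l) * E (X (Suc l)) \<omega> * E (D (Suc l)) \<omega>
          + (\<pi> (Suc l) + U (Suc l) * X k \<omega>) * E (D (Suc l)) \<omega>
        = P l * (E (\<lambda>\<omega>. X l \<omega> * D l \<omega>) \<omega> - E (X l) \<omega> * E (D l) \<omega>)
          + Q l * E (X l) \<omega> * E (D l) \<omega> + (\<pi> l + U l * X k \<omega>) * E (D l) \<omega>"
        unfolding P_rec[OF l(2)] Q_rec[OF l(2)] U_rec[OF l(2)] \<pi>_rec[OF l(2)] elim(1,2,3)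
        by (simp only: algebra_simps)
      then show ?case using elim(4) by simp
    qed
  qed
  show "AE \<omega> in M. 2 * (E (\<lambda>\<omega>. X N \<omega> * D N \<omega>) \<omega> - E (X N) \<omega> * E (D N) \<omega>)
      = - 2 * (U N * X k \<omega> + \<pi> N) * E (D N) \<omega>"
  proof -
    have "AE \<omega> in M. P N * (E (\<lambda>\<omega>. X N \<omega> * D N \<omega>) \<omega> - E (X N) \<omega> * E (D N) \<omega>)
      + Q N * E (X N) \<omega> * E (D N) \<omega> + (\<pi> N + U N * X k \<omega>) * E (D N) \<omega> = 0"
      using invariant[of N] k by simp
    then show ?thesis
      by eventually_elim (simp add: P_N Q_N algebra_simps)
  qed
qed

end

section \<open>Trajectories under feedback and under a one-time deviation\<close>

text \<open>\<open>mv_cost\<close> recomputes wealth from a control process; this identifies the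
  terminal wealth inside it when the control is the feedback law evaluated along its own
  trajectory.\<close>

lemma wealth_feedback:
  "wealth s e k y (\<lambda>l \<omega>. feedback_wealth s e \<Phi> v k y l \<omega> *\<^sub>R \<Phi> l + v l \<omega>) n
    = feedback_wealth s e \<Phi> v k y n"
  by (induction n) (auto simp: fun_eq_iff algebra_simps inner_simps)

lemma deviation_wealth_start:
  "deviation_wealth s e \<Phi> v k y w (Suc k) = (\<lambda>\<omega>. s k * y \<omega> + excess s e k \<omega> \<bullet> w \<omega>)"
  by (simp add: deviation_wealth_def)

lemma deviation_wealth_step:
  "k < l \<Longrightarrow> deviation_wealth s e \<Phi> v k y w (Suc l)
    = (\<lambda>\<omega>. (s l + excess s e l \<omega> \<bullet> \<Phi> l) * deviation_wealth s e \<Phi> v k y w l \<omega>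
        + excess s e l \<omega> \<bullet> v l \<omega>)"
  by (simp add: deviation_wealth_def)

lemma wealth_deviation:
  "wealth s e k y (\<lambda>l. if l = k then w
      else (\<lambda>\<omega>. deviation_wealth s e \<Phi> v k y w l \<omega> *\<^sub>R \<Phi> l + v l \<omega>)) n
    = deviation_wealth s e \<Phi> v k y w n"
proof (induction n)
  case 0
  then show ?case by (simp add: deviation_wealth_def)
next
  case (Suc n)
  \<comment> \<open>Up to \<open>k\<close> the state is frozen at \<open>y\<close>, period
    \<open>k\<close> uses \<open>w\<close>, and afterwards the feedback law reacts to the deviated
    state.\<close>
  consider "Suc n \<le> k" | "n = k" | "k < n" by linarith
  then show ?case
  proof cases
    case 1
    then show ?thesis by (simp add: deviation_wealth_def)
  next
    case 2
    with Suc show ?thesis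
      by (simp add: deviation_wealth_start) (simp add: deviation_wealth_def)
  next
    case 3
    with Suc show ?thesis
      by (auto simp: deviation_wealth_step fun_eq_iff algebra_simps inner_simps)
  qed
qed

text \<open>Start value and recursion determine the trajectory. It lets the same process
  \<open>X\<close> serve both for the trajectory from \<open>t\<close> and for those restarted at a
  later \<open>k\<close>.\<close>

lemma feedback_wealth_unique:
  assumes start: "X k = y"
    and step: "\<And>l. k \<le> l \<Longrightarrow> l < n \<Longrightarrow> X (Suc l)
      = (\<lambda>\<omega>. (s l + excess s e l \<omega> \<bullet> \<Phi> l) * X l \<omega> + excess s e l \<omega> \<bullet> v l \<omega>)"
    and l: "k \<le> l" "l \<le> n"
  shows "feedback_wealth s e \<Phi> v k y l = X l"
  using l
proof (induction rule: dec_induct)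
  case base
  show ?case by (cases k) (simp_all add: start[symmetric])
next
  case (step l)
  then show ?case using assms(2)[of l] by simp
qed

section \<open>From the solvable recursions to the mixed equilibrium\<close>

theorem proposition3p6:
  fixes M :: "'a measure" and N :: nat
    and s :: "nat \<Rightarrow> real" and e :: "nat \<Rightarrow> 'a \<Rightarrow> real^'m"
    and \<mu>1 \<mu>2 :: real
    and \<Phi> :: "nat \<Rightarrow> real^'m"
    and EO :: "nat \<Rightarrow> real^'m" and C :: "nat \<Rightarrow> real^'m^'m"
    and S \<S> T \<T> U \<pi> :: "nat \<Rightarrow> real"
    and \<O> :: "nat \<Rightarrow> real^'m^'m" and \<L> \<theta> \<beta> :: "nat \<Rightarrow> real^'m"
    and t :: nat and x :: "'a \<Rightarrow> real"
    and X :: "nat \<Rightarrow> 'a \<Rightarrow> real" and v :: "nat \<Rightarrow> 'a \<Rightarrow> real^'m"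
  assumes prob: "prob_space M"
    and N: "N \<ge> 1"
    and s: "\<forall>k<N. s k > 1"
    and e_indep: "prob_space.indep_vars M (\<lambda>_. borel) e {..<N}"
    and e_L2: "\<forall>k<N. e k \<in> borel_measurable M \<and> integrable M (\<lambda>\<omega>. (norm (e k \<omega>))\<^sup>2)"
    and mu: "\<mu>1 > 0" "\<mu>2 > 0"
    and EO: "\<forall>k<N. EO k = (\<integral>\<omega>. excess s e k \<omega> \<partial>M)"
    and C: "\<forall>k<N. C k = covariance_matrix M (excess s e k)"
    \<comment> \<open>quantities entering the two systems\<close>
    and S_N: "S N = 1"
    and S_rec: "\<forall>k<N. S k = S (k+1) * ((s k + EO k \<bullet> \<Phi> k)\<^sup>2 + (\<Phi> k v* C k) \<bullet> \<Phi> k)"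
    and cS_N: "\<S> N = 0"
    and cS_rec: "\<forall>k<N. \<S> k = \<S> (k+1) * (s k + EO k \<bullet> \<Phi> k)\<^sup>2
                              + S (k+1) * ((\<Phi> k v* C k) \<bullet> \<Phi> k)"
    and U_N: "U N = - (\<mu>1 / 2)"
    and U_rec: "\<forall>k<N. U k = (s k + EO k \<bullet> \<Phi> k) * U (k+1)"
    and cO: "\<forall>k<N. \<O> k = (\<S> (k+1) + \<T> (k+1)) *\<^sub>R outer (EO k) (EO k)
                         + (S (k+1) + T (k+1)) *\<^sub>R C k"
    and cL: "\<forall>k<N. \<L> k = (s k * (\<S> (k+1) + \<T> (k+1))) *\<^sub>R EO k + U (k+1) *\<^sub>R EO k"
    and theta: "\<forall>k<N. \<theta> k = \<pi> (k+1) *\<^sub>R EO k"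
    and beta: "\<forall>k<N. \<beta> k = ((\<S> (k+1) + \<T> (k+1)) * (s k + \<Phi> k \<bullet> EO k)) *\<^sub>R EO k
                           + (S (k+1) + T (k+1)) *\<^sub>R (\<Phi> k v* C k)"
    \<comment> \<open>first system\<close>
    and T_rec: "\<forall>k<N. T k =
          S (k+1) * (((s k + EO k \<bullet> \<Phi> k) *\<^sub>R EO k + \<Phi> k v* C k)
                       \<bullet> (- (moore_penrose (\<O> k) *v \<L> k) - \<Phi> k))
        + T (k+1) * ((s k + EO k \<bullet> \<Phi> k) * (s k - EO k \<bullet> (moore_penrose (\<O> k) *v \<L> k))
                       - (\<Phi> k v* C k) \<bullet> (moore_penrose (\<O> k) *v \<L> k))"
    and cT_rec: "\<forall>k<N. \<T> k =
          ((\<S> (k+1) * (s k + EO k \<bullet> \<Phi> k)) *\<^sub>R EO k + S (k+1) *\<^sub>R (\<Phi> k v* C k))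
             \<bullet> (- (moore_penrose (\<O> k) *v \<L> k) - \<Phi> k)
        + (\<T> (k+1) * (s k + EO k \<bullet> \<Phi> k) * (s k - EO k \<bullet> (moore_penrose (\<O> k) *v \<L> k))
             - T (k+1) * ((\<Phi> k v* C k) \<bullet> (moore_penrose (\<O> k) *v \<L> k)))"
    and T_N: "T N = 0" and cT_N: "\<T> N = 0"
    and cL_range: "\<forall>k<N. (\<O> k ** moore_penrose (\<O> k)) *v \<L> k = \<L> k"
    \<comment> \<open>second system\<close>
    and pi_rec: "\<forall>k<N. \<pi> k = - (\<beta> k \<bullet> (moore_penrose (\<O> k) *v \<theta> k))
                              + (s k + EO k \<bullet> \<Phi> k) * \<pi> (k+1)"
    and pi_N: "\<pi> N = - (\<mu>2 / 2)"
    and theta_range: "\<forall>k<N. (\<O> k ** moore_penrose (\<O> k)) *v \<theta> k = \<theta> k"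
    \<comment> \<open>the candidate for the initial pair\<close>
    and t: "t < N" and x: "x \<in> L2_adapted M e t"
    and X_t: "X t = x"
    and X_rec: "\<forall>k\<in>{t..<N}. X (k+1) =
          (\<lambda>\<omega>. (s k - excess s e k \<omega> \<bullet> (moore_penrose (\<O> k) *v \<L> k)) * X k \<omega>
                 - excess s e k \<omega> \<bullet> (moore_penrose (\<O> k) *v \<theta> k))"
    and v: "\<forall>k\<in>{t..<N}. v k =
          (\<lambda>\<omega>. - (X k \<omega> *\<^sub>R (moore_penrose (\<O> k) *v \<L> k + \<Phi> k))
                 - moore_penrose (\<O> k) *v \<theta> k)"
  shows "mixed_equilibrium M N s e \<mu>1 \<mu>2 t x (restrict \<Phi> {t..<N}) v"
proof -
  interpret market M N s e
    using prob e_indep e_L2 by (auto simp: market_def market_axioms_def)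
  define a where "a k = moore_penrose (\<O> k) *v \<L> k" for k
  define b where "b k = moore_penrose (\<O> k) *v \<theta> k" for k
  define P where "P k = S k + T k" for k
  define Q where "Q k = \<S> k + \<T> k" for k
  \<comment> \<open>Agrees with \<open>\<Phi>\<close> on \<open>{t..<N}\<close>, where all uses
    below take place.\<close>
  define \<Psi> where "\<Psi> = restrict \<Phi> {t..<N}"
  have EO': "EO k = mean k" and C': "C k = cov k" if "k < N" for k
    using EO C that by auto
  \<comment> \<open>On adding the equations of \<open>S\<close> and \<open>T\<close>, the terms
    quadratic in \<open>\<Phi> k\<close> cancel: one factor \<open>\<Phi> k\<close> is replaced by
    \<open>- a k\<close>, the coefficient of the equilibrium control. The same cancellation gives
    \<open>Q_rec\<close>.\<close>
  have P_rec: "P k = P (Suc k)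
      * ((s k + mean k \<bullet> \<Phi> k) * (s k - mean k \<bullet> a k) - (\<Phi> k v* cov k) \<bullet> a k)"
    if k: "k < N" for k
    unfolding P_def S_rec[rule_format, OF k] T_rec[rule_format, OF k] EO'[OF k] C'[OF k] a_def[symmetric]
    by (simp add: algebra_simps inner_simps power2_eq_square)
  have Q_rec: "Q k = Q (Suc k) * (s k + mean k \<bullet> \<Phi> k) * (s k - mean k \<bullet> a k)
      - P (Suc k) * ((\<Phi> k v* cov k) \<bullet> a k)"
    if k: "k < N" for k
    unfolding P_def Q_def cS_rec[rule_format, OF k] cT_rec[rule_format, OF k] EO'[OF k] C'[OF k]
      a_def[symmetric]
    by (simp add: algebra_simps inner_simps power2_eq_square)
  have \<pi>_rec: "\<pi> k = (s k + mean k \<bullet> \<Phi> k) * \<pi> (Suc k)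
      - Q (Suc k) * (s k + mean k \<bullet> \<Phi> k) * (mean k \<bullet> b k)
      - P (Suc k) * ((\<Phi> k v* cov k) \<bullet> b k)"
    if k: "k < N" for k
    unfolding P_def Q_def pi_rec[rule_format, OF k] beta[rule_format, OF k] EO'[OF k] C'[OF k]
      b_def[symmetric]
    by (simp add: algebra_simps inner_simps inner_commute[of "\<Phi> k"])
  \<comment> \<open>Pairing with \<open>z\<close> turns the two matrix equations for
    \<open>a k\<close> and \<open>b k\<close> into the scalar stationarity equations.\<close>
  have \<O>_inner: "z \<bullet> (\<O> k *v c) = Q (Suc k) * (mean k \<bullet> c) * (mean k \<bullet> z)
      + P (Suc k) * ((z v* cov k) \<bullet> c)" if k: "k < N" for k z c
  proof -
    have "outer (mean k) (mean k) *v c = (mean k \<bullet> c) *\<^sub>R mean k"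
      by (simp add: outer_def matrix_vector_mult_def vec_eq_iff inner_vec_def sum_distrib_left mult_ac)
    then show ?thesis
      unfolding P_def Q_def cO[rule_format, OF k] EO'[OF k] C'[OF k]
      by (simp add: matrix_vector_mult_add_rdistrib scaleR_matrix_vector_assoc[symmetric]
          inner_simps dot_lmul_matrix inner_commute[of "mean k" z])
  qed
  have \<O>_a: "\<O> k *v a k = \<L> k" and \<O>_b: "\<O> k *v b k = \<theta> k" if "k < N" for k
    using cL_range theta_range that by (simp_all add: a_def b_def matrix_vector_mul_assoc)
  have stationary_a: "Q (Suc k) * (mean k \<bullet> a k) * (mean k \<bullet> z)
      + P (Suc k) * ((z v* cov k) \<bullet> a k) = (s k * Q (Suc k) + U (Suc k)) * (mean k \<bullet> z)"
    if k: "k < N" for k z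
    unfolding \<O>_inner[OF k, symmetric] \<O>_a[OF k] cL[rule_format, OF k] EO'[OF k]
    by (simp add: Q_def inner_simps algebra_simps inner_commute)
  have stationary_b: "Q (Suc k) * (mean k \<bullet> b k) * (mean k \<bullet> z)
      + P (Suc k) * ((z v* cov k) \<bullet> b k) = \<pi> (Suc k) * (mean k \<bullet> z)"
    if k: "k < N" for k z
    unfolding \<O>_inner[OF k, symmetric] \<O>_b[OF k] theta[rule_format, OF k] EO'[OF k]
    by (simp add: inner_commute)
  have v': "v k = (\<lambda>\<omega>. - (X k \<omega> *\<^sub>R (a k + \<Phi> k)) - b k)" if "k \<in> {t..<N}" for k
    using v that by (simp add: a_def b_def)
  have X_step: "X (Suc k) = (\<lambda>\<omega>. (s k - excess s e k \<omega> \<bullet> a k) * X k \<omega> - excess s e k \<omega> \<bullet> b k)"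
    if "k \<in> {t..<N}" for k
    using X_rec that by (simp add: a_def b_def)
  \<comment> \<open>The open-loop part \<open>v\<close> compensates the feedback
    \<open>\<Psi>\<close> along \<open>X\<close>, so the closed loop reproduces the recursion of
    \<open>X\<close>.\<close>
  have X_feedback: "X (Suc k)
      = (\<lambda>\<omega>. (s k + excess s e k \<omega> \<bullet> \<Psi> k) * X k \<omega> + excess s e k \<omega> \<bullet> v k \<omega>)"
    if "k \<in> {t..<N}" for k
    using that by (simp add: X_step v' \<Psi>_def algebra_simps inner_simps)
  have XL: "X k \<in> L2 M (info M e k)" if "t \<le> k" "k \<le> N" for k
    using that
  proof (induction rule: dec_induct)
    case base
    show ?case using x X_t by (simp add: L2_adapted_eq_L2)
  next
    case (step k)
    then show ?case
      using affine_step_L2[of k "X k" "s k" "- a k" "- b k"] by (simp add: X_step)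
  qed
  have vL: "v k \<in> L2 M (info M e k)" and uL: "(\<lambda>\<omega>. X k \<omega> *\<^sub>R a k + b k) \<in> L2 M (info M e k)"
    if k: "k \<in> {t..<N}" for k
  proof -
    have sub: "subalgebra M (info M e k)" using k by (simp add: subalgebra_info)
    have lin: "(\<lambda>\<omega>. X k \<omega> *\<^sub>R c) \<in> L2 M (info M e k)" for c :: "real^'m"
      using L2_linear[OF sub XL bounded_linear_scaleR_left] k by auto
    show "(\<lambda>\<omega>. X k \<omega> *\<^sub>R a k + b k) \<in> L2 M (info M e k)"
      by (rule L2_add[OF sub lin L2_const])
    show "v k \<in> L2 M (info M e k)"
      using L2_diff[OF sub lin L2_const, of "- (a k + \<Phi> k)" "b k"]
      unfolding v'[OF k] scaleR_minus_right .
  qed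
  have optimal: "AE \<omega> in M.
      mv_cost M N s e \<mu>1 \<mu>2 k y (\<lambda>l \<omega>. feedback_wealth s e \<Psi> v k y l \<omega> *\<^sub>R \<Psi> l + v l \<omega>) \<omega>
      \<le> mv_cost M N s e \<mu>1 \<mu>2 k y
        (\<lambda>l. if l = k then w else (\<lambda>\<omega>. deviation_wealth s e \<Psi> v k y w l \<omega> *\<^sub>R \<Psi> l + v l \<omega>)) \<omega>"
    if k: "k \<in> {t..<N}" and w: "w \<in> L2 M (info M e k)" and y: "y = X k" for k w y
  proof -
    have kN: "k < N" and tk: "t \<le> k" using k by auto
    have sub: "subalgebra M (info M e k)" "subalgebra M (info M e N)"
      using kN by (simp_all add: subalgebra_info)
    \<comment> \<open>The equilibrium control at time \<open>k\<close> is
      \<open>- (X k \<omega> *\<^sub>R a k + b k)\<close>, so \<open>h\<close> is the deviating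
      control minus the equilibrium one.\<close>
    define h where "h \<omega> = w \<omega> + (X k \<omega> *\<^sub>R a k + b k)" for \<omega>
    define D where "D l \<omega> = deviation_wealth s e \<Psi> v k y w l \<omega> - X l \<omega>" for l \<omega>
    have "h \<in> L2 M (info M e k)"
      unfolding h_def[abs_def] by (rule L2_add[OF sub(1) w uL[OF k]])
    moreover have "D (Suc k) = (\<lambda>\<omega>. excess s e k \<omega> \<bullet> h \<omega>)"
      unfolding D_def[abs_def] h_def deviation_wealth_start X_step[OF k] y
      by (simp add: algebra_simps inner_simps)
    \<comment> \<open>Both trajectories use the same \<open>v\<close>, which cancels in the
      difference; after time \<open>k\<close> the deviation is propagated by the feedback
      alone.\<close>
    moreover have "D (Suc l) = (\<lambda>\<omega>. (s l + excess s e l \<omega> \<bullet> \<Phi> l) * D l \<omega>)" if l: "k < l" "l < N" for l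
    proof -
      have "l \<in> {t..<N}" using l tk by simp
      then show ?thesis
        unfolding D_def[abs_def] deviation_wealth_step[OF l(1)] X_feedback[OF \<open>l \<in> {t..<N}\<close>]
        by (simp add: \<Psi>_def algebra_simps)
    qed
    moreover have "X (Suc l) = (\<lambda>\<omega>. (s l - excess s e l \<omega> \<bullet> a l) * X l \<omega> - excess s e l \<omega> \<bullet> b l)"
      if "k \<le> l" "l < N" for l
      using X_step[of l] that tk by simp
    moreover have "U l = (s l + mean l \<bullet> \<Phi> l) * U (Suc l)" if "l < N" for l
      using U_rec that by (simp add: EO')
    ultimately have XN: "X N \<in> L2 M (info M e N)" and DN: "D N \<in> L2 M (info M e N)"
      and first_order: "AE \<omega> in M. 2 * (real_cond_exp M (info M e k) (\<lambda>\<omega>. X N \<omega> * D N \<omega>) \<omega>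
          - real_cond_exp M (info M e k) (X N) \<omega> * real_cond_exp M (info M e k) (D N) \<omega>)
        = - 2 * (U N * X k \<omega> + \<pi> N) * real_cond_exp M (info M e k) (D N) \<omega>"
      using first_order_condition[of k X h a b D \<Phi> P Q U \<pi>, OF kN XL[OF tk less_imp_le[OF kN]]
          _ _ _ _ P_rec Q_rec _ \<pi>_rec _ _ stationary_a[OF kN] stationary_b[OF kN]]
      by (auto simp: P_def Q_def S_N T_N cS_N cT_N)
    \<comment> \<open>The terminal values of \<open>U\<close> and \<open>\<pi>\<close> produce
      exactly the weight of the expected terminal wealth in the cost.\<close>
    have "- 2 * (U N * X k \<omega> + \<pi> N) = \<mu>1 * y \<omega> + \<mu>2" for \<omega>
      by (simp add: U_N pi_N y algebra_simps)
    then have "AE \<omega> in M. 2 * (real_cond_exp M (info M e k) (\<lambda>\<omega>. X N \<omega> * D N \<omega>) \<omega>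
          - real_cond_exp M (info M e k) (X N) \<omega> * real_cond_exp M (info M e k) (D N) \<omega>)
        = (\<mu>1 * y \<omega> + \<mu>2) * real_cond_exp M (info M e k) (D N) \<omega>"
      using first_order by simp
    \<comment> \<open>Here \<open>X N + D N\<close> is the terminal wealth of the deviating
      investor.\<close>
    from cond_mean_variance_le[OF sub XN DN this]
    have "AE \<omega> in M. real_cond_exp M (info M e k)
          (\<lambda>\<omega>'. (X N \<omega>' - real_cond_exp M (info M e k) (X N) \<omega>')\<^sup>2) \<omega>
          - (\<mu>1 * y \<omega> + \<mu>2) * real_cond_exp M (info M e k) (X N) \<omega>
      \<le> real_cond_exp M (info M e k) (\<lambda>\<omega>'. (deviation_wealth s e \<Psi> v k y w N \<omega>'
            - real_cond_exp M (info M e k) (deviation_wealth s e \<Psi> v k y w N) \<omega>')\<^sup>2) \<omega>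
          - (\<mu>1 * y \<omega> + \<mu>2) * real_cond_exp M (info M e k) (deviation_wealth s e \<Psi> v k y w N) \<omega>"
      by (simp add: D_def)
    moreover have "feedback_wealth s e \<Psi> v k y N = X N"
      using kN tk X_feedback by (intro feedback_wealth_unique[where n = N]) (auto simp: y)
    ultimately show ?thesis
      by (simp add: mv_cost_def Let_def wealth_feedback wealth_deviation)
  qed
  \<comment> \<open>The state at which the definition restarts the problem is the equilibrium wealth
    \<open>X k\<close>, so \<open>optimal\<close> applies to it.\<close>
  have "feedback_wealth s e \<Psi> v t x k = X k" if "k \<in> {t..<N}" for k
    using that X_feedback by (intro feedback_wealth_unique[where n = N]) (auto simp: X_t)
  then show ?thesis
    unfolding mixed_equilibrium_def \<Psi>_def[symmetric] L2_adapted_eq_L2 Let_def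
    using vL optimal by simp
qed

end
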